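(* Every $k\times\ell$ matrix $M=(m_{i,j})$ over $\mathbb K$ can be represented by a unique weighted network associated to a Go-diagram contained in a $k\times\ell$ rectangle. That is, there are a unique Go-diagram $D$ contained in a $k\times\ell$ rectangle and a unique choice of weights $a_b\in\mathbb K^*$ (for the boxes $b$ of $D$ containing a $+$) and $c_b\in\mathbb K$ (for the boxes $b$ of $D$ containing a black stone) such that the network $N_D$ has sources $1,\dots,k$ and, for all $1\le i\le k$ and $1\le j\le\ell$, $$m_{i,j}=\sum_P w(P),$$ where the sum is over all directed paths $P$ in $N_D$ from the source $i$ to the boundary vertex $k+j$.
   Context: $\mathbb K$ is an arbitrary field, $\mathbb K^*=\mathbb K\setminus\{0\}$, $n=k+\ell$, $[n]=\{1,\dots,n\}$. Partitions. A partition $\lambda$ contained in a $k\times(n-k)$ rectangle is identified with its Young diagram, aligned with the upper-left corner of the rectangle. Its southeast border is a lattice path of $n$ unit steps from the upper-right to the lower-left corner of the rectangle; label the steps $1,\dots,n$ in this order. $I(\lambda)\subset[n]$ is the set of labels of the $k$ vertical steps. The standard reading order of the boxes of $\lambda$ reads the bottom row from right to left, then the row above it from right to left, and so on. Diagrams and networks. A diagram in $\lambda$ is an arbitrary filling of the boxes of $\lambda$ by pluses $+$, black stones and white stones. The network $N_D$ of a diagram $D$ in $\lambda$ is the following weighted directed graph. There is an internal vertex for each box containing a $+$ (a $+$-vertex) or a black stone (a black vertex), and a boundary vertex $i$ for each border step labeled $i\in[n]$. From each internal vertex draw a horizontal edge to the right to the nearest $+$-vertex in its row, or, if there is none, to the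 boundary vertex at the right end of the row; and a vertical edge down to the nearest $+$-vertex in its column, or, if there is none, to the boundary vertex at the bottom of the column. (Edges may skip over stones and may cross without meeting.) Direct all edges left and down. The boundary vertices in $I(\lambda)$ are the sources, the others are sinks. A horizontal edge whose left vertex is a $+$-vertex in box $b$ has weight $a_b$; one whose left vertex is a black vertex in box $b$ has weight $c_b$; vertical edges have weight $1$. For a directed path $P$, $w(P)$ is the product of the weights of its edges. Go-diagrams. Let $s_i\in\mathfrak S_n$ be the transposition exchanging $i$ and $i+1$. The box in row $r$ (from the top) and column $c$ (from the left) of the rectangle is labeled by $s_{n-k+r-c}$; write $s_b$ for the label of box $b$. Reading the boxes $b_1,\dots,b_m$ of $\lambda$ in the standard reading order gives a reduced expression $\mathbf w=s_{b_1}\cdots s_{b_m}$ of a permutation (permutations are composed as functions). A diagram $D$ in $\lambda$ determines a subexpression $\mathbf v$ of $\mathbf w$ by replacing $s_b$ by $1$ for each box $b$ containing a $+$ and keeping $s_b$ for each box containing a stone. Let $v_{(0)}=1$ and let $v_{(j)}$ be the product of the first $j$ factors of $\mathbf v$. Then $D$ is a Go-diagram if (i) $\mathbf v$ is distinguished, i.e. $v_{(j)}\le v_{(j-1)}s_{b_j}$ in Bruhat order for all $j$ (equivalently, $b_j$ may contain a $+$ only if $v_{(j-1)}<v_{(j-1)}s_{b_j}$); and (ii) a stone in box $b_j$ is white if $v_{(j-1)}<v_{(j)}$ and black if $v_{(j-1)}>v_{(j)}$. *)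

theory Defs
  imports
    "HOL-Library.FuncSet"
    "HOL-Combinatorics.Transposition"
    "Jordan_Normal_Form.Matrix"
    "Graph_Theory.Arc_Walk"
begin

section \<open>Bruhat order on the symmetric group\<close>

text \<open>
  Permutations of \<open>{1..n}\<close> are functions on \<open>nat\<close> that fix everything outside \<open>{1..n}\<close>;
  the product is \<open>\<circ>\<close>.
\<close>

definition perm_length :: "nat \<Rightarrow> (nat \<Rightarrow> nat) \<Rightarrow> nat" where
  "perm_length n w = card {(i, j). 1 \<le> i \<and> i < j \<and> j \<le> n \<and> w j < w i}"

text \<open>
  The Bruhat order is the reflexive transitive closure of right multiplication by a
  reflection (a transposition) that increases the length.
\<close>

definition bruhat_step :: "nat \<Rightarrow> (nat \<Rightarrow> nat) \<Rightarrow> (nat \<Rightarrow> nat) \<Rightarrow> bool" where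
  "bruhat_step n u w \<longleftrightarrow>
     (\<exists>i j. 1 \<le> i \<and> i < j \<and> j \<le> n \<and> w = u \<circ> transpose i j) \<and> perm_length n u < perm_length n w"

definition bruhat_le :: "nat \<Rightarrow> (nat \<Rightarrow> nat) \<Rightarrow> (nat \<Rightarrow> nat) \<Rightarrow> bool" where
  "bruhat_le n = rtranclp (bruhat_step n)"

definition bruhat_less :: "nat \<Rightarrow> (nat \<Rightarrow> nat) \<Rightarrow> (nat \<Rightarrow> nat) \<Rightarrow> bool" where
  "bruhat_less n u w \<longleftrightarrow> bruhat_le n u w \<and> u \<noteq> w"


section \<open>Partitions in a rectangle\<close>

text \<open>
  A box is a pair \<open>(r, c)\<close>: row \<open>r\<close> from the top, column \<open>c\<close> from the left, both
  counted from 1. A partition is its sequence of row lengths, set to 0 outside \<open>{1..k}\<close> so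
  that equal partitions are equal functions.
\<close>

definition partition_in_rect :: "nat \<Rightarrow> nat \<Rightarrow> (nat \<Rightarrow> nat) \<Rightarrow> bool" where
  "partition_in_rect k l lam \<longleftrightarrow>
     (\<forall>r. r \<notin> {1..k} \<longrightarrow> lam r = 0) \<and>
     (\<forall>r\<in>{1..k}. lam r \<le> l) \<and>
     (\<forall>r\<in>{1..k}. \<forall>r'\<in>{1..k}. r \<le> r' \<longrightarrow> lam r' \<le> lam r)"

definition boxes :: "nat \<Rightarrow> (nat \<Rightarrow> nat) \<Rightarrow> (nat \<times> nat) set" where
  "boxes k lam = {(r, c). r \<in> {1..k} \<and> c \<in> {1..lam r}}"

definition reading_order :: "nat \<Rightarrow> (nat \<Rightarrow> nat) \<Rightarrow> (nat \<times> nat) list" where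
  "reading_order k lam =
     concat (map (\<lambda>r. map (\<lambda>c. (r, c)) (rev [1..<Suc (lam r)])) (rev [1..<Suc k]))"

text \<open>
  Labels of the southeast border path from the upper-right to the lower-left corner. The
  vertical step at the right end of row \<open>r\<close> comes after \<open>r - 1\<close> vertical and
  \<open>l - lam r\<close> horizontal steps; the horizontal step at the bottom of column \<open>c\<close> comes
  after \<open>l - c\<close> horizontal steps and one vertical step for each row meeting column \<open>c\<close>.
\<close>

definition row_label :: "nat \<Rightarrow> (nat \<Rightarrow> nat) \<Rightarrow> nat \<Rightarrow> nat" where
  "row_label l lam r = (r - 1) + (l - lam r) + 1"

definition col_label :: "nat \<Rightarrow> nat \<Rightarrow> (nat \<Rightarrow> nat) \<Rightarrow> nat \<Rightarrow> nat" where
  "col_label k l lam c = (l - c) + card {r \<in> {1..k}. c \<le> lam r} + 1"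

text \<open>The set \<open>I(\<lambda>)\<close>.\<close>

definition source_labels :: "nat \<Rightarrow> nat \<Rightarrow> (nat \<Rightarrow> nat) \<Rightarrow> nat set" where
  "source_labels k l lam = row_label l lam ` {1..k}"


section \<open>Diagrams and Go-diagrams\<close>

datatype filling = Plus | Black | White

type_synonym diagram = "nat \<times> nat \<Rightarrow> filling option"

definition is_diagram :: "nat \<Rightarrow> (nat \<Rightarrow> nat) \<Rightarrow> diagram \<Rightarrow> bool" where
  "is_diagram k lam D \<longleftrightarrow> dom D = boxes k lam"

definition plus_boxes :: "diagram \<Rightarrow> (nat \<times> nat) set" where
  "plus_boxes D = {b. D b = Some Plus}"

definition black_boxes :: "diagram \<Rightarrow> (nat \<times> nat) set" where
  "black_boxes D = {b. D b = Some Black}"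

text \<open>
  Here \<open>l = n - k\<close>. For boxes of the rectangle \<open>l + r - c\<close> lies in \<open>{1..<k + l}\<close>, so the
  subtraction does not truncate.
\<close>

definition box_refl :: "nat \<Rightarrow> nat \<times> nat \<Rightarrow> nat \<Rightarrow> nat" where
  "box_refl l b = (case b of (r, c) \<Rightarrow> transpose (l + r - c) (l + r - c + 1))"

definition subexpr_prod :: "nat \<Rightarrow> diagram \<Rightarrow> (nat \<times> nat) list \<Rightarrow> nat \<Rightarrow> nat" where
  "subexpr_prod l D bs = foldr (\<circ>) (map (\<lambda>b. if D b = Some Plus then id else box_refl l b) bs) id"

definition go_diagram :: "nat \<Rightarrow> nat \<Rightarrow> (nat \<Rightarrow> nat) \<Rightarrow> diagram \<Rightarrow> bool" where
  "go_diagram k l lam D \<longleftrightarrow>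
     is_diagram k lam D \<and>
     (let bs = reading_order k lam; v = (\<lambda>j. subexpr_prod l D (take j bs)) in
       \<forall>j\<in>{1..length bs}. let b = bs ! (j - 1) in
         bruhat_le (k + l) (v j) (v (j - 1) \<circ> box_refl l b) \<and>
         (D b = Some White \<longrightarrow> bruhat_less (k + l) (v (j - 1)) (v j)) \<and>
         (D b = Some Black \<longrightarrow> bruhat_less (k + l) (v j) (v (j - 1))))"


section \<open>The network of a diagram\<close>

datatype vertex = Internal "nat \<times> nat" | Boundary nat

text \<open>
  Each internal vertex \<open>b\<close> is the left end of exactly one horizontal edge \<open>Hor b\<close> and the
  upper end of exactly one vertical edge \<open>Ver b\<close>. As edges are directed left and down,
  \<open>b\<close> is the head of \<open>Hor b\<close> and the tail of \<open>Ver b\<close>.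
\<close>

datatype edge = Hor "nat \<times> nat" | Ver "nat \<times> nat"

definition right_end :: "nat \<Rightarrow> (nat \<Rightarrow> nat) \<Rightarrow> diagram \<Rightarrow> nat \<times> nat \<Rightarrow> vertex" where
  "right_end l lam D b = (case b of (r, c) \<Rightarrow>
     if \<exists>c'>c. D (r, c') = Some Plus
     then Internal (r, LEAST c'. c < c' \<and> D (r, c') = Some Plus)
     else Boundary (row_label l lam r))"

definition lower_end :: "nat \<Rightarrow> nat \<Rightarrow> (nat \<Rightarrow> nat) \<Rightarrow> diagram \<Rightarrow> nat \<times> nat \<Rightarrow> vertex" where
  "lower_end k l lam D b = (case b of (r, c) \<Rightarrow>
     if \<exists>r'>r. D (r', c) = Some Plus
     then Internal (LEAST r'. r < r' \<and> D (r', c) = Some Plus, c)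
     else Boundary (col_label k l lam c))"

definition network :: "nat \<Rightarrow> nat \<Rightarrow> (nat \<Rightarrow> nat) \<Rightarrow> diagram \<Rightarrow> (vertex, edge) pre_digraph" where
  "network k l lam D =
     \<lparr>verts = Internal ` (plus_boxes D \<union> black_boxes D) \<union> Boundary ` {1..k + l},
      arcs = Hor ` (plus_boxes D \<union> black_boxes D) \<union> Ver ` (plus_boxes D \<union> black_boxes D),
      tail = (\<lambda>e. case e of Hor b \<Rightarrow> right_end l lam D b | Ver b \<Rightarrow> Internal b),
      head = (\<lambda>e. case e of Hor b \<Rightarrow> Internal b | Ver b \<Rightarrow> lower_end k l lam D b)\<rparr>"

fun edge_weight ::
  "diagram \<Rightarrow> (nat \<times> nat \<Rightarrow> 'a) \<Rightarrow> (nat \<times> nat \<Rightarrow> 'a) \<Rightarrow> edge \<Rightarrow> 'a::field" where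
  "edge_weight D a c (Hor b) = (if D b = Some Plus then a b else c b)"
| "edge_weight D a c (Ver b) = 1"

definition path_weight ::
  "diagram \<Rightarrow> (nat \<times> nat \<Rightarrow> 'a) \<Rightarrow> (nat \<times> nat \<Rightarrow> 'a) \<Rightarrow> edge list \<Rightarrow> 'a::field" where
  "path_weight D a c P = prod_list (map (edge_weight D a c) P)"

text \<open>
  The network is finite, so there are finitely many simple paths and the sums below are
  genuine; since it is also acyclic, every directed walk is a simple path.
\<close>

definition network_paths ::
  "nat \<Rightarrow> nat \<Rightarrow> (nat \<Rightarrow> nat) \<Rightarrow> diagram \<Rightarrow> nat \<Rightarrow> nat \<Rightarrow> edge list set" where
  "network_paths k l lam D i j =
     {P. pre_digraph.apath (network k l lam D) (Boundary i) P (Boundary j)}"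

text \<open>
  The weights are extensional (\<open>undefined\<close> off the boxes that carry them), so that
  uniqueness concerns only the weights of the network.
\<close>

definition weight_choice ::
  "diagram \<Rightarrow> (nat \<times> nat \<Rightarrow> 'a) \<Rightarrow> (nat \<times> nat \<Rightarrow> 'a::field) \<Rightarrow> bool" where
  "weight_choice D a c \<longleftrightarrow> a \<in> plus_boxes D \<rightarrow>\<^sub>E UNIV - {0} \<and> c \<in> black_boxes D \<rightarrow>\<^sub>E UNIV"

end

theory Submission
  imports Defs
begin

text \<open>
  The sources \<open>1, \<dots>, k\<close> force the partition to be the full rectangle. Row \<open>r\<close> of the matrix is a
  linear combination of the vectors \<open>F(c)\<close> of weights of paths entering column \<open>c\<close> just below row
  \<open>r\<close>, and these vectors are unitriangular. So, reading the boxes in the standard order, the top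
  remaining coefficient of the row determines the content of the next box: at a black stone it is the
  weight; otherwise it is nonzero for a \<open>+\<close> (and yields the weight) and zero for a white stone. The Go
  condition says precisely that a box is black if and only if the reflection of the box is a descent of the
  permutation read so far, which depends only on earlier boxes. Since exactly one of
  \<open>v s < v\<close> and \<open>v < v s\<close> holds, this greedy procedure never has a choice and never gets stuck.
\<close>

lemma diagram_cases: "D b = None \<or> D b = Some Plus \<or> D b = Some Black \<or> D b = Some White"
  for D :: diagram
proof (cases "D b")
  case (Some x)
  then show ?thesis by (cases x) auto
qed simp

section \<open>Descents\<close>

lemma adjacent_transpose_less_iff:
  fixes x y :: nat
  assumes "{x, y} \<noteq> {i, Suc i}"
  shows "transpose i (Suc i) x < transpose i (Suc i) y \<longleftrightarrow> x < y"
  using assms by (auto simp: transpose_def doubleton_eq_iff)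

text \<open>Exchanging the positions i and i+1 matches the inversions of \<open>v\<close> other than
  (i, i+1) with those of the product, and exactly one of the two permutations inverts (i,
  i+1).\<close>

lemma perm_length_comp_adjacent:
  assumes "inj v" "1 \<le> i" "Suc i \<le> n"
  shows "perm_length n (v \<circ> transpose i (Suc i)) \<noteq> perm_length n v"
proof -
  let ?t = "transpose i (Suc i)"
  define I where "I = (\<lambda>u :: nat \<Rightarrow> nat. {(a, b). 1 \<le> a \<and> a < b \<and> b \<le> n \<and> u b < u a})"
  have fin: "finite (I u)" for u
    by (rule finite_subset[of _ "{..n} \<times> {..n}"]) (auto simp: I_def)
  have bound: "1 \<le> ?t a" "?t a \<le> n" if "1 \<le> a" "a \<le> n" for a
    using that assms(2,3) by (auto simp: transpose_def)
  have sub: "map_prod ?t ?t ` (I u - {(i, Suc i)}) \<subseteq> I (u \<circ> ?t) - {(i, Suc i)}" for u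
  proof (rule image_subsetI)
    fix p assume "p \<in> I u - {(i, Suc i)}"
    then obtain a b where p: "p = (a, b)" "1 \<le> a" "a < b" "b \<le> n" "u b < u a" "(a, b) \<noteq> (i, Suc i)"
      by (auto simp: I_def)
    have ne: "{a, b} \<noteq> {i, Suc i}"
      using p by (auto simp: doubleton_eq_iff)
    have "(?t a, ?t b) \<noteq> (i, Suc i)"
      using p ne by (auto simp: transpose_def doubleton_eq_iff split: if_splits)
    then show "map_prod ?t ?t p \<in> I (u \<circ> ?t) - {(i, Suc i)}"
      using p adjacent_transpose_less_iff[OF ne] bound[of a] bound[of b] by (auto simp: I_def)
  qed
  have inj: "inj_on (map_prod ?t ?t) X" for X
    by (rule inj_on_subset[OF prod.inj_map]) auto
  have le: "card (I u - {(i, Suc i)}) \<le> card (I (u \<circ> ?t) - {(i, Suc i)})" for u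
    using card_mono[OF _ sub[of u]] fin by (simp add: card_image[OF inj])
  have "v \<circ> ?t \<circ> ?t = v"
    by (simp add: fun_eq_iff)
  \<comment> \<open>The inequality \<open>le\<close> goes one way only, but for every
    \<open>u\<close>; using it for \<open>v\<close> and for \<open>v \<circ> ?t\<close> gives
    equality.\<close>
  then have eq: "card (I (v \<circ> ?t) - {(i, Suc i)}) = card (I v - {(i, Suc i)})"
    using le[of v] le[of "v \<circ> ?t"] by simp
  have "v i \<noteq> v (Suc i)"
    using assms(1) by (simp add: inj_eq)
  then have "(i, Suc i) \<in> I (v \<circ> ?t) \<longleftrightarrow> (i, Suc i) \<notin> I v"
    using assms(2,3) by (auto simp: I_def)
  moreover have "card (I u) = card (I u - {(i, Suc i)}) + of_bool ((i, Suc i) \<in> I u)" for u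
    using card_Suc_Diff1[OF fin, of "(i, Suc i)" u] by auto
  ultimately have "card (I (v \<circ> ?t)) \<noteq> card (I v)"
    using eq by simp
  then show ?thesis
    by (simp add: perm_length_def I_def)
qed

lemma bruhat_le_imp_length: "bruhat_le n u w \<Longrightarrow> u = w \<or> perm_length n u < perm_length n w"
  unfolding bruhat_le_def
  by (induction rule: rtranclp_induct) (auto simp: bruhat_step_def)

text \<open>Every Bruhat step raises the length, and an adjacent transposition that raises it is
  itself one step. This turns the Go conditions into length comparisons.\<close>

lemma bruhat_le_comp_adjacent_iff:
  assumes "inj v" "1 \<le> i" "Suc i \<le> n"
  shows "bruhat_le n v (v \<circ> transpose i (Suc i)) \<longleftrightarrow>
    perm_length n v < perm_length n (v \<circ> transpose i (Suc i))"
proof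
  assume "bruhat_le n v (v \<circ> transpose i (Suc i))"
  then show "perm_length n v < perm_length n (v \<circ> transpose i (Suc i))"
    using bruhat_le_imp_length perm_length_comp_adjacent[OF assms] by metis
next
  assume "perm_length n v < perm_length n (v \<circ> transpose i (Suc i))"
  then have "bruhat_step n v (v \<circ> transpose i (Suc i))"
    unfolding bruhat_step_def using assms(2,3) by (metis lessI)
  then show "bruhat_le n v (v \<circ> transpose i (Suc i))"
    by (simp add: bruhat_le_def)
qed

section \<open>The reading order and the Go condition\<close>

definition precedes :: "nat \<times> nat \<Rightarrow> nat \<times> nat \<Rightarrow> bool" where
  "precedes b b' \<longleftrightarrow> fst b' < fst b \<or> fst b = fst b' \<and> snd b' < snd b"

text \<open>The value 0 outside \<open>{1..k}\<close> is the one that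
  \<open>partition_in_rect\<close> prescribes, so the partition forced by the sources is literally
  equal to this function.\<close>

definition full_rect :: "nat \<Rightarrow> nat \<Rightarrow> nat \<Rightarrow> nat" where
  "full_rect k l r = (if r \<in> {1..k} then l else 0)"

lemma full_rect_simp [simp]: "r \<in> {1..k} \<Longrightarrow> full_rect k l r = l"
  by (simp add: full_rect_def)

lemma boxes_full_rect: "boxes k (full_rect k l) = {1..k} \<times> {1..l}"
  by (auto simp: boxes_def)

lemma set_reading_order: "set (reading_order k lam) = boxes k lam"
  by (auto simp: reading_order_def boxes_def image_iff)

text \<open>It yields at once that no box is read twice and that the boxes before a given position
  are exactly ones read earlier.\<close>

lemma sorted_reading_order: "sorted_wrt precedes (reading_order k lam)"
proof -
  have rev_upt: "sorted_wrt (>) (rev [1..<m])" for m :: nat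
    by (simp add: sorted_wrt_rev)
  have row: "sorted_wrt precedes (map (\<lambda>c. (r, c)) (rev [1..<m]))" for r m
    unfolding sorted_wrt_map by (rule sorted_wrt_mono_rel[OF _ rev_upt]) (simp add: precedes_def)
  \<comment> \<open>Generalised from the rows k, ..., 1 to any decreasing list of rows, so that
    induction on the list applies.\<close>
  have "sorted_wrt precedes (concat (map (\<lambda>r. map (\<lambda>c. (r, c)) (rev [1..<Suc (lam r)])) rs))"
    if "sorted_wrt (>) rs" for rs
    using that
  proof (induction rs)
    case (Cons r rs)
    then show ?case
      using row[of r "Suc (lam r)"]
      by (simp add: sorted_wrt_append del: upt_Suc) (auto simp: precedes_def)
  qed simp
  then show ?thesis
    unfolding reading_order_def using rev_upt by blast
qed

text \<open>This is the partial product v_(j-1) for b = b_j, indexed by the box instead of its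
  position.\<close>

definition state_before ::
  "nat \<Rightarrow> nat \<Rightarrow> diagram \<Rightarrow> nat \<times> nat \<Rightarrow> nat \<Rightarrow> nat" where
  "state_before k l D b =
     subexpr_prod l D (takeWhile (\<lambda>b'. b' \<noteq> b) (reading_order k (full_rect k l)))"

definition descent_at ::
  "nat \<Rightarrow> nat \<Rightarrow> diagram \<Rightarrow> nat \<times> nat \<Rightarrow> bool" where
  "descent_at k l D b \<longleftrightarrow>
     perm_length (k + l) (state_before k l D b \<circ> box_refl l b) < perm_length (k + l) (state_before k l D b)"

lemma takeWhile_reading_order:
  assumes "j < length (reading_order k lam)"
  shows "takeWhile (\<lambda>b'. b' \<noteq> reading_order k lam ! j) (reading_order k lam) =
    take j (reading_order k lam)"
proof (rule takeWhile_eq_take_P_nth)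
  fix i assume "i < j" "i < length (reading_order k lam)"
  then have "precedes (reading_order k lam ! i) (reading_order k lam ! j)"
    using sorted_wrt_nth_less[OF sorted_reading_order] assms by blast
  then show "reading_order k lam ! i \<noteq> reading_order k lam ! j"
    by (auto simp: precedes_def)
qed simp

text \<open>The partial product before \<open>b\<close> involves the contents of earlier boxes, but
  not of \<open>b\<close> itself. This is what allows a construction box by box.\<close>

lemma descent_at_cong:
  assumes "b \<in> {1..k} \<times> {1..l}"
    and "\<And>b'. b' \<in> {1..k} \<times> {1..l} \<Longrightarrow> precedes b' b \<Longrightarrow> D b' = D' b'"
  shows "descent_at k l D b = descent_at k l D' b"
proof -
  let ?bs = "reading_order k (full_rect k l)"
  obtain j where j: "j < length ?bs" "b = ?bs ! j"
    using assms(1) set_reading_order[of k "full_rect k l"]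
    by (metis boxes_full_rect in_set_conv_nth)
  have "b' \<in> {1..k} \<times> {1..l} \<and> precedes b' b" if b': "b' \<in> set (take j ?bs)" for b'
  proof
    show "b' \<in> {1..k} \<times> {1..l}"
      using in_set_takeD[OF b'] by (simp add: set_reading_order boxes_full_rect)
    show "precedes b' b"
      using b' sorted_wrt_nth_less[OF sorted_reading_order] j by (auto simp: in_set_conv_nth)
  qed
  then have "map (\<lambda>b. if D b = Some Plus then id else box_refl l b) (take j ?bs) =
      map (\<lambda>b. if D' b = Some Plus then id else box_refl l b) (take j ?bs)"
    using assms(2) by (intro map_cong) simp_all
  then have "state_before k l D b = state_before k l D' b"
    using j unfolding state_before_def subexpr_prod_def
    by (simp only: takeWhile_reading_order)
  then show ?thesis
    by (simp add: descent_at_def)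
qed

lemma inj_subexpr_prod: "inj (subexpr_prod l D bs)"
proof (induction bs)
  case (Cons b bs)
  have "inj (box_refl l b)"
    by (cases b) (simp add: box_refl_def)
  with Cons show ?case
    using inj_compose[of "box_refl l b" "subexpr_prod l D bs"]
    by (auto simp: subexpr_prod_def comp_def)
qed (simp add: subexpr_prod_def)

text \<open>The product is folded from the front, whereas v_(j) arises from v_(j-1) by a new factor
  on the right.\<close>

lemma subexpr_prod_snoc:
  "subexpr_prod l D (bs @ [b]) =
    subexpr_prod l D bs \<circ> (if D b = Some Plus then id else box_refl l b)"
  by (induction bs) (auto simp: subexpr_prod_def comp_assoc)

text \<open>At a descent, v s < v excludes both a \<open>+\<close> (which needs v \<le> v s) and a
  white stone (which needs v < v s), so black remains. At an ascent exactly the black stone is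
  excluded.\<close>

lemma go_diagram_full_rect_iff:
  "go_diagram k l (full_rect k l) D \<longleftrightarrow>
    dom D = {1..k} \<times> {1..l} \<and>
    (\<forall>b\<in>{1..k} \<times> {1..l}. D b = Some Black \<longleftrightarrow> descent_at k l D b)"
proof (cases "dom D = {1..k} \<times> {1..l}")
  case True
  define bs where "bs = reading_order k (full_rect k l)"
  define v where "v = (\<lambda>j. subexpr_prod l D (take j bs))"
  define ok where "ok = (\<lambda>j. let b = bs ! (j - 1) in
         bruhat_le (k + l) (v j) (v (j - 1) \<circ> box_refl l b) \<and>
         (D b = Some White \<longrightarrow> bruhat_less (k + l) (v (j - 1)) (v j)) \<and>
         (D b = Some Black \<longrightarrow> bruhat_less (k + l) (v j) (v (j - 1))))"
  have ok: "ok (Suc j) \<longleftrightarrow> (D (bs ! j) = Some Black \<longleftrightarrow> descent_at k l D (bs ! j))"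
    if j: "j < length bs" for j
  proof -
    let ?u = "v j" and ?s = "box_refl l (bs ! j)"
    have inb: "bs ! j \<in> {1..k} \<times> {1..l}"
      using j by (metis boxes_full_rect bs_def nth_mem set_reading_order)
    then obtain r c where rc: "bs ! j = (r, c)" "r \<in> {1..k}" "c \<in> {1..l}"
      by auto
    define i where "i = l + r - c"
    have i: "1 \<le> i" "Suc i \<le> k + l" and s: "?s = transpose i (Suc i)"
      using rc by (auto simp: i_def box_refl_def)
    have inj: "inj ?u" "inj (?u \<circ> ?s)"
      by (auto simp: v_def s inj_subexpr_prod intro!: inj_compose)
    have invol: "?u \<circ> ?s \<circ> ?s = ?u"
      by (simp add: s fun_eq_iff)
    have next_v: "v (Suc j) = ?u \<circ> (if D (bs ! j) = Some Plus then id else ?s)"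
      using j by (simp add: v_def take_Suc_conv_app_nth subexpr_prod_snoc)
    have state: "state_before k l D (bs ! j) = ?u"
      using j by (simp add: state_before_def v_def bs_def takeWhile_reading_order)
    have ne: "perm_length (k + l) (?u \<circ> ?s) \<noteq> perm_length (k + l) ?u"
      using perm_length_comp_adjacent[OF inj(1) i] by (simp add: s)
    have up: "bruhat_le (k + l) ?u (?u \<circ> ?s) \<longleftrightarrow> \<not> descent_at k l D (bs ! j)"
      using bruhat_le_comp_adjacent_iff[OF inj(1) i] ne
      by (auto simp: s[symmetric] descent_at_def state)
    \<comment> \<open>The same criterion for \<open>?u \<circ> ?s\<close> in place of
      \<open>?u\<close>; a second factor \<open>?s\<close> leads back to \<open>?u\<close>.\<close>
    have down: "bruhat_le (k + l) (?u \<circ> ?s) ?u \<longleftrightarrow> descent_at k l D (bs ! j)"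
      using bruhat_le_comp_adjacent_iff[OF inj(2) i] invol
      by (simp add: s[symmetric] descent_at_def state)
    have refl: "bruhat_le (k + l) w w" for w
      by (simp add: bruhat_le_def)
    have moves: "?u \<circ> ?s \<noteq> ?u"
      using ne by metis
    have ok_Suc: "ok (Suc j) \<longleftrightarrow> bruhat_le (k + l) (v (Suc j)) (?u \<circ> ?s) \<and>
        (D (bs ! j) = Some White \<longrightarrow> bruhat_less (k + l) ?u (v (Suc j))) \<and>
        (D (bs ! j) = Some Black \<longrightarrow> bruhat_less (k + l) (v (Suc j)) ?u)"
      by (simp only: ok_def Let_def diff_Suc_1)
    have "D (bs ! j) \<noteq> None"
      using inb True by auto
    then consider "D (bs ! j) = Some Plus" | "D (bs ! j) = Some Black" | "D (bs ! j) = Some White"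
      using diagram_cases[of D "bs ! j"] by (elim disjE) simp_all
    then show ?thesis
    proof cases
      case 1
      then have "v (Suc j) = ?u"
        using next_v by simp
      with 1 show ?thesis
        using up ok_Suc by simp
    next
      case 2
      then have "v (Suc j) = ?u \<circ> ?s"
        using next_v by simp
      with 2 show ?thesis
        using down refl moves ok_Suc unfolding bruhat_less_def by auto
    next
      case 3
      then have "v (Suc j) = ?u \<circ> ?s"
        using next_v by simp
      with 3 show ?thesis
        using up refl moves ok_Suc unfolding bruhat_less_def by auto
    qed
  qed
  have "go_diagram k l (full_rect k l) D \<longleftrightarrow> (\<forall>j\<in>{1..length bs}. ok j)"
    using True by (simp add: go_diagram_def is_diagram_def boxes_full_rect Let_def bs_def v_def ok_def)
  also have "\<dots> \<longleftrightarrow> (\<forall>j<length bs. ok (Suc j))"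
    by (metis Suc_le_eq Suc_le_D atLeastAtMost_iff One_nat_def le_add1 plus_1_eq_Suc)
  also have "\<dots> \<longleftrightarrow> (\<forall>b\<in>set bs. D b = Some Black \<longleftrightarrow> descent_at k l D b)"
    using ok by (auto simp: all_set_conv_all_nth)
  finally show ?thesis
    using True by (simp add: bs_def set_reading_order boxes_full_rect)
qed (simp add: go_diagram_def is_diagram_def boxes_full_rect)

text \<open>For k > 0 the last row has label k + (l - lam k), which exceeds k unless that row has
  length l; the rows above are at least as long.\<close>

lemma source_labels_initial_iff:
  assumes "partition_in_rect k l lam"
  shows "source_labels k l lam = {1..k} \<longleftrightarrow> lam = full_rect k l"
proof
  assume labels: "source_labels k l lam = {1..k}"
  have "lam r = full_rect k l r" for r
  proof (cases "r \<in> {1..k}")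
    case True
    then have "k \<in> {1..k}" by auto
    then have "row_label l lam k \<in> {1..k}"
      using labels by (auto simp: source_labels_def)
    then have "l \<le> lam k"
      using True by (auto simp: row_label_def)
    moreover have "lam k \<le> lam r" "lam r \<le> l"
      using assms True by (auto simp: partition_in_rect_def)
    ultimately show ?thesis
      using True by simp
  next
    case False
    then show ?thesis
      using assms by (auto simp: partition_in_rect_def full_rect_def)
  qed
  then show "lam = full_rect k l" by blast
next
  assume "lam = full_rect k l"
  then have "row_label l lam r = r" if "r \<in> {1..k}" for r
    using that by (simp add: row_label_def)
  then show "source_labels k l lam = {1..k}"
    by (simp add: source_labels_def)
qed

lemma partition_full_rect: "partition_in_rect k l (full_rect k l)"
  by (auto simp: partition_in_rect_def full_rect_def)

section \<open>The transfer recursion along rows\<close>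

text \<open>
  \<open>hor D w r f c j\<close> is the weight of all ways to continue from the horizontal edge just right of
  box \<open>(r, c)\<close> to sink \<open>j\<close>, given the weights \<open>f\<close> of the continuations
  that enter the rows below \<open>r\<close>.
\<close>

primrec hor ::
  "diagram \<Rightarrow> (nat \<times> nat \<Rightarrow> 'a) \<Rightarrow> nat \<Rightarrow> (nat \<Rightarrow> nat \<Rightarrow> 'a) \<Rightarrow> nat \<Rightarrow> nat \<Rightarrow> 'a::field" where
  "hor D w r f 0 j = 0"
| "hor D w r f (Suc c) j =
    (if D (r, Suc c) = Some Plus then w (r, Suc c) * (f (Suc c) j + hor D w r f c j)
     else if D (r, Suc c) = Some Black then w (r, Suc c) * f (Suc c) j + hor D w r f c j
     else hor D w r f c j)"

text \<open>
  Here \<open>q\<close> is the number of rows below the entry point, so the row just passed is \<open>k - q\<close>.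
  Sinks are indexed by their column: \<open>j\<close> stands for the boundary vertex \<open>k + l + 1 - j\<close>.
\<close>

primrec ver ::
  "diagram \<Rightarrow> (nat \<times> nat \<Rightarrow> 'a) \<Rightarrow> nat \<Rightarrow> nat \<Rightarrow> nat \<Rightarrow> nat \<Rightarrow> 'a::field" where
  "ver D w k 0 c j = of_bool (c = j)"
| "ver D w k (Suc q) c j =
    ver D w k q c j +
    (if D (k - q, c) = Some Plus then hor D w (k - q) (ver D w k q) (c - 1) j else 0)"

text \<open>A path from source r enters row r at its right end, past column l, with k - r rows below
  it.\<close>

definition entry ::
  "diagram \<Rightarrow> (nat \<times> nat \<Rightarrow> 'a) \<Rightarrow> nat \<Rightarrow> nat \<Rightarrow> nat \<Rightarrow> nat \<Rightarrow> 'a::field" where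
  "entry D w k l r = hor D w r (ver D w k (k - r)) l"

text \<open>Paths only move left and down: from column c they reach no sink further right, and the
  sink under c only by going straight down. Columns range over all of \<open>nat\<close>, in
  accordance with the Kronecker delta that starts \<open>ver\<close>.\<close>

definition unitriangular ::
  "(nat \<Rightarrow> nat \<Rightarrow> 'a::field) \<Rightarrow> bool" where
  "unitriangular f \<longleftrightarrow> (\<forall>c. f c c = 1 \<and> (\<forall>j>c. f c j = 0))"

lemma hor_eq_0:
  assumes "unitriangular f" "c < j"
  shows "hor D w r f c j = 0"
  using assms(2) by (induction c) (use assms(1) in \<open>auto simp: unitriangular_def\<close>)

text \<open>Passing a row adds to the vector of column c only contributions from columns left of c,
  and these vanish from position c on.\<close>

lemma unitriangular_ver: "unitriangular (ver D w k q)"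
proof (induction q)
  case (Suc q)
  have "hor D w (k - q) (ver D w k q) (c - 1) j = 0" if "c \<le> j" for c j
    using that hor_eq_0[OF Suc, of "c - 1" j] by (cases c) auto
  with Suc show ?case
    by (auto simp: unitriangular_def)
qed (simp add: unitriangular_def)

text \<open>Agreement of \<open>f\<close> and \<open>f'\<close> is demanded at the single sink
  \<open>j\<close>: the path sums below fix their sink and enter as a vector that is constant in
  this argument.\<close>

lemma hor_cong:
  assumes "\<And>c'. c' \<in> {1..c} \<Longrightarrow> D (r, c') = D' (r, c')"
    and "\<And>c'. c' \<in> {1..c} \<Longrightarrow> D (r, c') \<in> {Some Plus, Some Black} \<Longrightarrow> w (r, c') = w' (r, c')"
    and "\<And>c'. c' \<in> {1..c} \<Longrightarrow> f c' j = f' c' j"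
  shows "hor D w r f c j = hor D' w' r f' c j"
  using assms
proof (induction c)
  case (Suc c)
  have "hor D w r f c j = hor D' w' r f' c j"
    by (rule Suc.IH) (use Suc.prems in auto)
  then show ?case
    using Suc.prems[of "Suc c"] by auto
qed simp

text \<open>\<open>ver\<close> visits only the q lowest rows, so the vectors used by a row are fixed
  once the rows below it are filled.\<close>

lemma ver_cong:
  assumes "\<And>b. b \<in> {k - q<..k} \<times> {1..l} \<Longrightarrow> D b = D' b"
    and "\<And>b. b \<in> {k - q<..k} \<times> {1..l} \<Longrightarrow> D b \<in> {Some Plus, Some Black} \<Longrightarrow> w b = w' b"
    and "q \<le> k" "c \<in> {1..l}"
  shows "ver D w k q c j = ver D' w' k q c j"
  using assms
proof (induction q arbitrary: c)
  case (Suc q)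
  have row: "{k - Suc q<..k} = insert (k - q) {k - q<..k}"
    using Suc.prems(3) by auto
  have IH: "ver D w k q c' j = ver D' w' k q c' j" if "c' \<in> {1..l}" for c'
  proof (rule Suc.IH)
    show "D b = D' b" "D b \<in> {Some Plus, Some Black} \<Longrightarrow> w b = w' b"
      if "b \<in> {k - q<..k} \<times> {1..l}" for b
      using Suc.prems(1,2)[of b] that unfolding row by blast+
  qed (use Suc.prems(3) that in auto)
  have "hor D w (k - q) (ver D w k q) (c - 1) j = hor D' w' (k - q) (ver D' w' k q) (c - 1) j"
  proof (rule hor_cong)
    fix c' assume "c' \<in> {1..c - 1}"
    then have c': "c' \<in> {1..l}" using Suc.prems(4) by auto
    then show "D (k - q, c') = D' (k - q, c')"
      and "D (k - q, c') \<in> {Some Plus, Some Black} \<Longrightarrow> w (k - q, c') = w' (k - q, c')"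
      using Suc.prems(1,2)[of "(k - q, c')"] unfolding row by blast+
    show "ver D w k q c' j = ver D' w' k q c' j"
      using IH[OF c'] .
  qed
  moreover have "D (k - q, c) = D' (k - q, c)"
    using Suc.prems(1)[of "(k - q, c)"] Suc.prems(4) unfolding row by blast
  ultimately show ?case
    using IH[OF Suc.prems(4)] by simp
qed simp

lemma entry_cong:
  assumes "\<And>b. b \<in> {r..k} \<times> {1..l} \<Longrightarrow> D b = D' b"
    and "\<And>b. b \<in> {r..k} \<times> {1..l} \<Longrightarrow> D b \<in> {Some Plus, Some Black} \<Longrightarrow> w b = w' b"
    and "r \<in> {1..k}"
  shows "entry D w k l r j = entry D' w' k l r j"
  unfolding entry_def
proof (rule hor_cong)
  fix c assume c: "c \<in> {1..l}"
  then have "(r, c) \<in> {r..k} \<times> {1..l}" using assms(3) by auto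
  then show "D (r, c) = D' (r, c)"
    and "D (r, c) \<in> {Some Plus, Some Black} \<Longrightarrow> w (r, c) = w' (r, c)"
    using assms(1,2) by blast+
  show "ver D w k (k - r) c j = ver D' w' k (k - r) c j"
  proof (rule ver_cong)
    fix b assume "b \<in> {k - (k - r)<..k} \<times> {1..l}"
    then have "b \<in> {r..k} \<times> {1..l}" using assms(3) by auto
    then show "D b = D' b" "D b \<in> {Some Plus, Some Black} \<Longrightarrow> w b = w' b"
      using assms(1,2) by blast+
  qed (use c in auto)
qed

section \<open>Path sums\<close>

context fin_digraph
begin

context
  fixes rank :: "'a \<Rightarrow> nat"
  assumes rank: "\<And>e. e \<in> arcs G \<Longrightarrow> rank (head G e) < rank (tail G e)"
begin

lemma ranked_awalk_verts:
  assumes "awalk u p v" "x \<in> set (awalk_verts u p)"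
  shows "rank x \<le> rank u"
  using assms
proof (induction p arbitrary: u)
  case (Cons e p)
  then have e: "e \<in> arcs G" "u = tail G e" and p: "awalk (head G e) p v"
    by (auto simp: awalk_Cons_iff)
  from Cons.prems(2) consider "x = u" | "x \<in> set (awalk_verts (head G e) p)"
    using e by auto
  then show ?case
    using Cons.IH[OF p] rank[OF e(1)] e(2) by cases auto
qed simp

text \<open>The first arc lowers the rank strictly and the rest of the walk never rises above that
  lower rank, so a walk cannot return to its start.\<close>

lemma ranked_awalk_iff_apath: "awalk u p v \<longleftrightarrow> apath u p v"
proof
  assume "awalk u p v"
  then show "apath u p v"
  proof (induction p arbitrary: u)
    case (Cons e p)
    then have e: "e \<in> arcs G" "u = tail G e" and p: "awalk (head G e) p v"
      by (auto simp: awalk_Cons_iff)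
    have "tail G e \<notin> set (awalk_verts (head G e) p)"
      using ranked_awalk_verts[OF p] rank[OF e(1)] by fastforce
    then show ?case
      using e p Cons.IH by (simp add: apath_Cons_iff)
  qed (simp add: apath_def)
qed (rule awalkI_apath)

text \<open>As every walk is a path, an arc can be put in front without checking that its tail is
  new.\<close>

lemma ranked_apaths_step:
  assumes "u \<noteq> v"
  shows "{p. apath u p v} = (\<Union>e\<in>out_arcs G u. (#) e ` {p. apath (head G e) p v})"
proof (rule Set.set_eqI)
  fix p show "p \<in> {p. apath u p v} \<longleftrightarrow> p \<in> (\<Union>e\<in>out_arcs G u. (#) e ` {p. apath (head G e) p v})"
    using assms by (cases p) (auto simp: ranked_awalk_iff_apath[symmetric] awalk_simps)
qed

lemma ranked_apaths_trivial:
  assumes "v \<in> verts G"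
  shows "{p. apath v p v} = {[]}"
proof -
  have "p = []" if "apath v p v" for p
  proof (cases p)
    case (Cons e p')
    then have "awalk (head G e) p' v" "v \<notin> set (awalk_verts (head G e) p')"
      using that by (auto simp: apath_Cons_iff awalkI_apath)
    then show ?thesis
      by (metis awalk_conv awalk_verts_non_Nil last_in_set)
  qed
  then show ?thesis
    using assms by (auto simp: apath_Nil_iff)
qed

lemma finite_ranked_apaths: "finite {p. apath u p v}"
proof (induction "rank u" arbitrary: u rule: less_induct)
  case less
  show ?case
  proof (cases "u = v")
    case True
    have "p = []" if "apath u p v" for p
      using that True ranked_apaths_trivial[of v] awalk_last_in_verts[OF awalkI_apath[OF that]] by auto
    \<comment> \<open>Only an inclusion, because the set is empty if \<open>v\<close> is not a
      vertex.\<close>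
    then have "{p. apath u p v} \<subseteq> {[]}" by auto
    then show ?thesis by (rule finite_subset) simp
  next
    case False
    show ?thesis
      unfolding ranked_apaths_step[OF False]
    proof (intro finite_UN_I finite_out_arcs finite_imageI)
      fix e assume "e \<in> out_arcs G u"
      then show "finite {p. apath (head G e) p v}"
        using less[of "head G e"] rank[of e] by simp
    qed
  qed
qed

text \<open>Paths are sorted by their first arc. In the network of a diagram this becomes the
  recursion of \<open>hor\<close> and \<open>ver\<close>.\<close>

lemma ranked_path_sum:
  fixes wt :: "'b \<Rightarrow> 'c::comm_semiring_1"
  assumes "u \<noteq> v"
  shows "(\<Sum>p | apath u p v. prod_list (map wt p)) =
    (\<Sum>e\<in>out_arcs G u. wt e * (\<Sum>p | apath (head G e) p v. prod_list (map wt p)))"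
proof -
  have "(\<Sum>p | apath u p v. prod_list (map wt p)) =
      (\<Sum>e\<in>out_arcs G u. \<Sum>p\<in>(#) e ` {p. apath (head G e) p v}. prod_list (map wt p))"
    unfolding ranked_apaths_step[OF assms]
    by (rule sum.UNION_disjoint) (use finite_ranked_apaths in \<open>auto simp: finite_out_arcs\<close>)
  also have "\<dots> = (\<Sum>e\<in>out_arcs G u. wt e * (\<Sum>p | apath (head G e) p v. prod_list (map wt p)))"
    by (simp add: sum.reindex sum_distrib_left)
  finally show ?thesis .
qed

end

end

text \<open>The two weight families live on disjoint sets of boxes, so one function can carry both
  through the recursion.\<close>

definition box_weight ::
  "diagram \<Rightarrow> (nat \<times> nat \<Rightarrow> 'a) \<Rightarrow> (nat \<times> nat \<Rightarrow> 'a) \<Rightarrow> nat \<times> nat \<Rightarrow> 'a" where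
  "box_weight D a b x = (if D x = Some Plus then a x else b x)"

section \<open>The network of a filled rectangle, with a fixed sink \<open>t\<close>\<close>

context
  fixes k l :: nat and D :: diagram and a b :: "nat \<times> nat \<Rightarrow> 'a::field" and t :: nat
  assumes dom: "dom D = {1..k} \<times> {1..l}" and t: "k < t" "t \<le> k + l"
begin

abbreviation "N \<equiv> network k l (full_rect k l) D"

abbreviation "wt \<equiv> box_weight D a b"

definition sum_from :: "vertex \<Rightarrow> 'a" where
  "sum_from u = (\<Sum>p | pre_digraph.apath N u p (Boundary t). path_weight D a b p)"

definition is_vertex :: "nat \<times> nat \<Rightarrow> bool" where
  "is_vertex x \<longleftrightarrow> D x = Some Plus \<or> D x = Some Black"

lemma is_vertexD: "is_vertex (r, c) \<Longrightarrow> r \<in> {1..k} \<and> c \<in> {1..l}"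
  using domI[of D "(r, c)"] unfolding dom is_vertex_def by blast

lemma plusD: "D (r, c) = Some Plus \<Longrightarrow> is_vertex (r, c)"
  by (simp add: is_vertex_def)

lemma vertices: "plus_boxes D \<union> black_boxes D = Collect is_vertex"
  by (auto simp: plus_boxes_def black_boxes_def is_vertex_def)

lemma right_end_cases:
  assumes "is_vertex (r, c)"
  obtains c' where "c < c'" "D (r, c') = Some Plus" "\<forall>c''\<in>{c<..<c'}. D (r, c'') \<noteq> Some Plus"
      "right_end l (full_rect k l) D (r, c) = Internal (r, c')"
  | "\<forall>c''>c. D (r, c'') \<noteq> Some Plus" "right_end l (full_rect k l) D (r, c) = Boundary r"
proof (cases "\<exists>c'>c. D (r, c') = Some Plus")
  case True
  define m where "m = (LEAST c'. c < c' \<and> D (r, c') = Some Plus)"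
  have m: "c < m \<and> D (r, m) = Some Plus"
    unfolding m_def by (rule LeastI_ex) (use True in blast)
  have least: "\<forall>c''\<in>{c<..<m}. D (r, c'') \<noteq> Some Plus"
  proof
    fix c'' assume "c'' \<in> {c<..<m}"
    then show "D (r, c'') \<noteq> Some Plus"
      using not_less_Least[of c'' "\<lambda>c'. c < c' \<and> D (r, c') = Some Plus"] by (simp add: m_def)
  qed
  have "right_end l (full_rect k l) D (r, c) = Internal (r, m)"
    using True by (simp add: right_end_def m_def)
  with m least show ?thesis
    by (intro that(1)) simp_all
next
  case False
  then show ?thesis
    using that(2) is_vertexD[OF assms] by (auto simp: right_end_def row_label_def)
qed

lemma lower_end_cases:
  assumes "c \<in> {1..l}"
  obtains r' where "r < r'" "D (r', c) = Some Plus" "\<forall>r''\<in>{r<..<r'}. D (r'', c) \<noteq> Some Plus"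
      "lower_end k l (full_rect k l) D (r, c) = Internal (r', c)"
  | "\<forall>r''>r. D (r'', c) \<noteq> Some Plus"
      "lower_end k l (full_rect k l) D (r, c) = Boundary (k + (Suc l - c))"
proof (cases "\<exists>r'>r. D (r', c) = Some Plus")
  case True
  define m where "m = (LEAST r'. r < r' \<and> D (r', c) = Some Plus)"
  have m: "r < m \<and> D (m, c) = Some Plus"
    unfolding m_def by (rule LeastI_ex) (use True in blast)
  have least: "\<forall>r''\<in>{r<..<m}. D (r'', c) \<noteq> Some Plus"
  proof
    fix r'' assume "r'' \<in> {r<..<m}"
    then show "D (r'', c) \<noteq> Some Plus"
      using not_less_Least[of r'' "\<lambda>r'. r < r' \<and> D (r', c) = Some Plus"] by (simp add: m_def)
  qed
  have "lower_end k l (full_rect k l) D (r, c) = Internal (m, c)"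
    using True by (simp add: lower_end_def m_def)
  with m least show ?thesis
    by (intro that(1)) simp_all
next
  case False
  have "{r \<in> {1..k}. c \<le> full_rect k l r} = {1..k}"
    using assms by auto
  then have "col_label k l (full_rect k l) c = k + (Suc l - c)"
    using assms by (simp add: col_label_def Suc_diff_le)
  then show ?thesis
    using that(2) False by (auto simp: lower_end_def)
qed

text \<open>The graph-side form of the step from \<open>q\<close> to \<open>Suc q\<close> in
  \<open>ver\<close>. Here \<open>r - 1\<close> may be 0, a position above the top row.\<close>

lemma lower_end_step:
  assumes "r \<in> {1..k}"
  shows "lower_end k l (full_rect k l) D (r - 1, c) =
    (if D (r, c) = Some Plus then Internal (r, c) else lower_end k l (full_rect k l) D (r, c))"
proof (cases "D (r, c) = Some Plus")
  case True
  have "(LEAST r'. r - 1 < r' \<and> D (r', c) = Some Plus) = r"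
    by (rule Least_equality) (use True assms in auto)
  moreover have "\<exists>r'>r - 1. D (r', c) = Some Plus"
    using True assms by (intro exI[of _ r]) auto
  ultimately show ?thesis
    using True by (simp add: lower_end_def)
next
  case False
  have "r - 1 < r' \<and> D (r', c) = Some Plus \<longleftrightarrow> r < r' \<and> D (r', c) = Some Plus" for r'
    using False assms by (cases "r' = r") auto
  then show ?thesis
    using False by (simp add: lower_end_def)
qed

text \<open>Moving left lowers c and moving down lowers k - r. Sources lie above all internal ranks,
  and sinks lie below them because columns start at 1.\<close>

definition vertex_rank :: "vertex \<Rightarrow> nat" where
  "vertex_rank u = (case u of Internal (r, c) \<Rightarrow> (k - r) + c | Boundary i \<Rightarrow> if i \<le> k then Suc (k + l) else 0)"

lemma network_simps:
  "verts N = Internal ` Collect is_vertex \<union> Boundary ` {1..k + l}"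
  "arcs N = Hor ` Collect is_vertex \<union> Ver ` Collect is_vertex"
  "tail N (Hor x) = right_end l (full_rect k l) D x" "tail N (Ver x) = Internal x"
  "head N (Hor x) = Internal x" "head N (Ver x) = lower_end k l (full_rect k l) D x"
  by (simp_all add: network_def vertices)

lemma right_end_in_verts:
  assumes "is_vertex x"
  shows "right_end l (full_rect k l) D x \<in> verts N"
proof -
  obtain r c where x: "x = (r, c)" by fastforce
  show ?thesis
    using is_vertexD[of r c] plusD[of r] assms unfolding x
    by (rule_tac right_end_cases[of r c]) (auto simp: network_simps image_iff)
qed

lemma lower_end_in_verts:
  assumes "is_vertex x"
  shows "lower_end k l (full_rect k l) D x \<in> verts N"
proof -
  obtain r c where x: "x = (r, c)" by fastforce
  then have "c \<in> {1..l}" using assms is_vertexD by auto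
  then show ?thesis
    unfolding x using plusD[of _ c]
    by (rule_tac lower_end_cases[of c r]) (auto simp: network_simps image_iff)
qed

lemma finite_vertices: "finite (Collect is_vertex)"
  by (rule finite_subset[of _ "{1..k} \<times> {1..l}"]) (use is_vertexD in auto)

lemma fin_digraph_network: "fin_digraph N"
proof unfold_locales
  fix e assume "e \<in> arcs N"
  then obtain x where x: "is_vertex x" and e: "e = Hor x \<or> e = Ver x"
    by (auto simp: network_simps(2))
  then have "Internal x \<in> verts N"
    by (simp add: network_simps(1))
  with e show "tail N e \<in> verts N" "head N e \<in> verts N"
    using right_end_in_verts[OF x] lower_end_in_verts[OF x]
    by (auto simp only: network_simps(3-6))
qed (simp_all add: network_simps(1,2) finite_vertices)

lemma rank_network:
  assumes "e \<in> arcs N"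
  shows "vertex_rank (head N e) < vertex_rank (tail N e)"
proof -
  obtain r c where e: "e = Hor (r, c) \<or> e = Ver (r, c)" and v: "is_vertex (r, c)"
    using assms by (auto simp: network_simps)
  note rc = is_vertexD[OF v]
  from e show ?thesis
  proof
    assume "e = Hor (r, c)"
    then show ?thesis
      by (rule_tac right_end_cases[OF v]) (use rc in \<open>auto simp: network_simps vertex_rank_def\<close>)
  next
    assume "e = Ver (r, c)"
    moreover have "c \<in> {1..l}" using rc by blast
    moreover have "r' \<le> k" if "D (r', c) = Some Plus" for r'
      using is_vertexD[OF plusD[OF that]] by simp
    ultimately show ?thesis
      using rc by (rule_tac lower_end_cases[of c r]) (auto simp: network_simps vertex_rank_def diff_less_mono2)
  qed
qed

lemma sum_from_step:
  assumes "u \<noteq> Boundary t"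
  shows "sum_from u = (\<Sum>e\<in>out_arcs N u. edge_weight D a b e * sum_from (head N e))"
  unfolding sum_from_def path_weight_def
  by (rule fin_digraph.ranked_path_sum[OF fin_digraph_network rank_network assms])

text \<open>Horizontal edges start at \<open>+\<close>-vertices or at row labels, which are at most
  k, so no arc leaves a sink.\<close>

lemma sum_from_sink:
  assumes "k < i" "i \<le> k + l"
  shows "sum_from (Boundary i) = of_bool (i = t)"
proof (cases "i = t")
  case True
  have "Boundary t \<in> verts N"
    using t by (auto simp: network_simps)
  then show ?thesis
    using True fin_digraph.ranked_apaths_trivial[OF fin_digraph_network rank_network]
    by (simp add: sum_from_def path_weight_def)
next
  case False
  have "right_end l (full_rect k l) D (r, c) \<noteq> Boundary i" if "is_vertex (r, c)" for r c
    by (rule right_end_cases[OF that]) (use is_vertexD[OF that] assms in auto)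
  then have "out_arcs N (Boundary i) = {}"
    by (auto simp: network_simps)
  then show ?thesis
    using False by (simp add: sum_from_step)
qed

text \<open>
  The columns whose vertices in row \<open>r\<close> are heads of the horizontal edges crossing the right side of
  column \<open>c\<close>: all these edges start at the same vertex.
\<close>

definition reach :: "nat \<Rightarrow> nat \<Rightarrow> nat set" where
  "reach r c = {c'. c' \<le> c \<and> is_vertex (r, c') \<and> (\<forall>c''\<in>{c'<..c}. D (r, c'') \<noteq> Some Plus)}"

text \<open>The path-sum counterpart of \<open>hor\<close>; \<open>sum_down\<close> is that of
  \<open>ver\<close>.\<close>

definition sum_left :: "nat \<Rightarrow> nat \<Rightarrow> 'a" where
  "sum_left r c = (\<Sum>c'\<in>reach r c. wt (r, c') * sum_from (Internal (r, c')))"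

definition sum_down :: "nat \<Rightarrow> nat \<Rightarrow> 'a" where
  "sum_down r c = sum_from (lower_end k l (full_rect k l) D (r, c))"

lemma reach_vertex: "c' \<in> reach r c \<Longrightarrow> is_vertex (r, c')"
  by (simp add: reach_def)

lemma finite_reach: "finite (reach r c)"
  by (rule finite_subset[of _ "{..c}"]) (auto simp: reach_def)

text \<open>This determines the arcs leaving an internal vertex to the left. The condition
  \<open>c \<ge> 1\<close> keeps \<open>c - 1\<close> from truncating.\<close>

lemma right_end_eq_Internal_iff:
  assumes "is_vertex (r', c')"
  shows "right_end l (full_rect k l) D (r', c') = Internal (r, c) \<longleftrightarrow>
    r' = r \<and> D (r, c) = Some Plus \<and> c \<ge> 1 \<and> c' \<in> reach r (c - 1)"
proof (rule right_end_cases[OF assms])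
  fix m assume m: "c' < m" "D (r', m) = Some Plus" "\<forall>c''\<in>{c'<..<m}. D (r', c'') \<noteq> Some Plus"
    "right_end l (full_rect k l) D (r', c') = Internal (r', m)"
  \<comment> \<open>\<open>m\<close> and \<open>c\<close> are both the nearest \<open>+\<close> to
    the right of \<open>c'\<close>, so neither lies strictly between \<open>c'\<close> and the
    other.\<close>
  have "m = c" if "D (r', c) = Some Plus" "c' < c" "\<forall>c''\<in>{c'<..c - 1}. D (r', c'') \<noteq> Some Plus"
  proof (rule linorder_cases[of m c])
    assume "m < c"
    then have "m \<in> {c'<..c - 1}" using m(1) by simp
    then show ?thesis using that(3) m(2) by blast
  next
    assume "c < m"
    then have "c \<in> {c'<..<m}" using that(2) by simp
    then show ?thesis using that(1) m(3) by blast
  qed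
  then have "r' = r \<and> D (r, c) = Some Plus \<and> c \<ge> 1 \<and> c' \<in> reach r (c - 1) \<Longrightarrow> r' = r \<and> m = c"
    by (simp add: reach_def) linarith
  moreover have "{c'<..m - 1} = {c'<..<m}"
    using m(1) by auto
  then have "c' \<in> reach r' (m - 1)" "m \<ge> 1"
    using m(1,3) assms by (simp_all add: reach_def)
  ultimately show ?thesis
    unfolding m(4) using m(2) by blast
next
  assume "\<forall>c''>c'. D (r', c'') \<noteq> Some Plus" "right_end l (full_rect k l) D (r', c') = Boundary r'"
  then show ?thesis by (auto simp: reach_def)
qed

lemma right_end_eq_source_iff:
  assumes "is_vertex (r', c')"
  shows "right_end l (full_rect k l) D (r', c') = Boundary r \<longleftrightarrow> r' = r \<and> c' \<in> reach r l"
proof (rule right_end_cases[OF assms])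
  fix m assume m: "c' < m" "D (r', m) = Some Plus"
    "right_end l (full_rect k l) D (r', c') = Internal (r', m)"
  then have "m \<in> {c'<..l}" using is_vertexD[OF plusD[OF m(2)]] by simp
  then have "c' \<notin> reach r' l" using m(2) unfolding reach_def by blast
  then show ?thesis using m(3) by auto
next
  assume "\<forall>c''>c'. D (r', c'') \<noteq> Some Plus" "right_end l (full_rect k l) D (r', c') = Boundary r'"
  then show ?thesis using assms is_vertexD[OF assms] by (auto simp: reach_def)
qed

lemma sum_Hor:
  assumes "\<And>c'. c' \<in> R \<Longrightarrow> is_vertex (r, c')"
  shows "(\<Sum>e\<in>(\<lambda>c'. Hor (r, c')) ` R. edge_weight D a b e * sum_from (head N e)) =
    (\<Sum>c'\<in>R. wt (r, c') * sum_from (Internal (r, c')))"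
  by (subst sum.reindex) (use assms in \<open>auto simp: inj_on_def network_simps box_weight_def\<close>)

lemma sum_from_source:
  assumes "r \<in> {1..k}"
  shows "sum_from (Boundary r) = sum_left r l"
proof -
  have "out_arcs N (Boundary r) = (\<lambda>c'. Hor (r, c')) ` reach r l"
    using right_end_eq_source_iff[of _ _ r] reach_vertex by (auto simp: network_simps image_iff)
  then show ?thesis
    using assms t sum_Hor[of "reach r l" r] by (simp add: sum_from_step sum_left_def reach_def)
qed

text \<open>Horizontal edges end on the right at a \<open>+\<close>-vertex or at the border, so a
  path can only leave a black vertex downwards.\<close>

lemma sum_from_Internal:
  assumes "is_vertex (r, c)"
  shows "sum_from (Internal (r, c)) =
    sum_down r c + (if D (r, c) = Some Plus then sum_left r (c - 1) else 0)"
proof (cases "D (r, c) = Some Plus")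
  case True
  have "c \<ge> 1" using is_vertexD[OF assms] by simp
  then have "out_arcs N (Internal (r, c)) = insert (Ver (r, c)) ((\<lambda>c'. Hor (r, c')) ` reach r (c - 1))"
    using right_end_eq_Internal_iff[of _ _ r c] assms True reach_vertex
    by (auto simp: network_simps image_iff) blast
  then show ?thesis
    using True sum_Hor[of "reach r (c - 1)" r] finite_reach[of r "c - 1"]
    by (simp add: sum_from_step sum_left_def sum_down_def network_simps reach_def image_iff)
next
  case False
  then have "out_arcs N (Internal (r, c)) = {Ver (r, c)}"
    using right_end_eq_Internal_iff[of _ _ r c] assms by (auto simp: network_simps)
  then show ?thesis
    using False by (simp add: sum_from_step sum_down_def network_simps)
qed

text \<open>A \<open>+\<close> in the new column catches all horizontal edges from its left, a black
  vertex joins those already present, and a white stone is skipped: the three clauses of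
  \<open>hor\<close>. The argument \<open>j\<close> is a dummy, since the sink is fixed.\<close>

lemma sum_left_eq_hor: "sum_left r c = hor D wt r (\<lambda>c' _. sum_down r c') c j"
proof (induction c)
  case 0
  have "reach r 0 = {}"
    using is_vertexD by (fastforce simp: reach_def)
  then show ?case by (simp add: sum_left_def)
next
  case (Suc c)
  consider "D (r, Suc c) = Some Plus" | "D (r, Suc c) = Some Black" | "\<not> is_vertex (r, Suc c)"
    by (auto simp: is_vertex_def)
  then show ?case
  proof cases
    case 1
    then have v: "is_vertex (r, Suc c)" by (rule plusD)
    with 1 have "reach r (Suc c) = {Suc c}"
      by (auto simp: reach_def le_Suc_eq)
    then show ?thesis
      using 1 Suc sum_from_Internal[OF v] by (simp add: sum_left_def)
  next
    case 2
    then have v: "is_vertex (r, Suc c)" by (simp add: is_vertex_def)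
    have "c' \<in> reach r (Suc c) \<longleftrightarrow> c' = Suc c \<or> c' \<in> reach r c" for c'
    proof (cases "c' \<le> c")
      case True
      then have "{c'<..Suc c} = insert (Suc c) {c'<..c}" by auto
      then show ?thesis using True 2 by (simp add: reach_def)
    next
      case False
      then show ?thesis using v by (auto simp: reach_def)
    qed
    then have "reach r (Suc c) = insert (Suc c) (reach r c)"
      by blast
    moreover have "Suc c \<notin> reach r c"
      by (simp add: reach_def)
    ultimately show ?thesis
      using 2 Suc sum_from_Internal[OF v] finite_reach[of r c] by (simp add: sum_left_def)
  next
    case 3
    then have "reach r (Suc c) = reach r c"
      using plusD by (auto simp: reach_def le_Suc_eq)
    then show ?thesis
      using 3 Suc by (simp add: sum_left_def is_vertex_def)
  qed
qed

text \<open>Sinks are numbered from right to left, so \<open>t\<close> lies below column k + l + 1 -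
  t.\<close>

lemma sum_down_eq_ver:
  assumes "q \<le> k" "c \<in> {1..l}"
  shows "sum_down (k - q) c = ver D wt k q c (k + Suc l - t)"
  using assms
proof (induction q arbitrary: c)
  case 0
  have "lower_end k l (full_rect k l) D (k, c) = Boundary (k + (Suc l - c))"
  proof (rule lower_end_cases[OF 0(2), of k])
    fix r' assume "k < r'" "D (r', c) = Some Plus"
    then show ?thesis using is_vertexD[OF plusD] by fastforce
  qed
  then show ?case
    using 0 t sum_from_sink[of "k + (Suc l - c)"] by (auto simp: sum_down_def)
next
  case (Suc q)
  define r where "r = k - q"
  have r: "r \<in> {1..k}" "k - Suc q = r - 1"
    using Suc.prems by (auto simp: r_def)
  have IH: "sum_down r c' = ver D wt k q c' (k + Suc l - t)" if "c' \<in> {1..l}" for c'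
    using Suc that by (simp add: r_def)
  have "sum_left r (c - 1) = hor D wt r (\<lambda>c' _. sum_down r c') (c - 1) (k + Suc l - t)"
    by (rule sum_left_eq_hor)
  also have "\<dots> = hor D wt r (ver D wt k q) (c - 1) (k + Suc l - t)"
    by (rule hor_cong) (use IH Suc.prems in auto)
  finally have left: "sum_left r (c - 1) = hor D wt r (ver D wt k q) (c - 1) (k + Suc l - t)" .
  have "sum_down (r - 1) c =
      sum_down r c + (if D (r, c) = Some Plus then sum_left r (c - 1) else 0)"
  proof (cases "D (r, c) = Some Plus")
    case True
    then show ?thesis
      using sum_from_Internal[OF plusD[OF True]] lower_end_step[OF r(1), of c]
      by (simp add: sum_down_def)
  next
    case False
    then show ?thesis
      using lower_end_step[OF r(1), of c] by (simp add: sum_down_def)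
  qed
  also have "\<dots> = ver D wt k (Suc q) c (k + Suc l - t)"
    using left IH[OF Suc.prems(2)] by (simp add: r_def)
  finally show ?case
    unfolding r(2) .
qed

lemma path_sum_eq_entry:
  assumes "r \<in> {1..k}"
  shows "(\<Sum>p\<in>network_paths k l (full_rect k l) D r t. path_weight D a b p) =
    entry D wt k l r (k + Suc l - t)"
proof -
  have "(\<Sum>p\<in>network_paths k l (full_rect k l) D r t. path_weight D a b p) =
      hor D wt r (\<lambda>c' _. sum_down r c') l (k + Suc l - t)"
    using sum_from_source[OF assms] sum_left_eq_hor by (simp add: sum_from_def network_paths_def)
  also have "\<dots> = hor D wt r (ver D wt k (k - r)) l (k + Suc l - t)"
    using sum_down_eq_ver[of "k - r"] assms by (intro hor_cong) auto
  finally show ?thesis by (simp add: entry_def)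
qed

end

section \<open>Filling the boxes greedily\<close>

text \<open>\<open>P\<close> will be \<open>descent_at k l\<close>. The greedy argument uses only
  that \<open>P\<close> at a box depends on earlier boxes, as captured by
  \<open>determined_by_past\<close>.\<close>

definition obeys ::
  "(diagram \<Rightarrow> nat \<times> nat \<Rightarrow> bool) \<Rightarrow> diagram \<Rightarrow> (nat \<times> nat \<Rightarrow> 'a::field) \<Rightarrow> nat \<times> nat \<Rightarrow> bool" where
  "obeys P D w b \<longleftrightarrow>
     D b \<noteq> None \<and> (D b = Some Black \<longleftrightarrow> P D b) \<and> (D b = Some Plus \<longrightarrow> w b \<noteq> 0)"

definition determined_by_past ::
  "(nat \<times> nat) set \<Rightarrow> (diagram \<Rightarrow> nat \<times> nat \<Rightarrow> bool) \<Rightarrow> bool" where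
  "determined_by_past B P \<longleftrightarrow>
     (\<forall>b\<in>B. \<forall>D D'. (\<forall>b'\<in>B. precedes b' b \<longrightarrow> D b' = D' b') \<longrightarrow> P D b = P D' b)"

lemma determined_by_pastD:
  assumes "determined_by_past B P" "b \<in> B" "\<And>b'. b' \<in> B \<Longrightarrow> precedes b' b \<Longrightarrow> D b' = D' b'"
  shows "P D b = P D' b"
  using assms unfolding determined_by_past_def by blast


text \<open>Elimination from right to left: the columns up to c contribute nothing to sink c+1, so
  the box in column c+1 must produce that coefficient alone. The filling and the target vary in the
  induction because each box changes both.\<close>

lemma row_exists:
  fixes y :: "nat \<Rightarrow> 'a::field" and f :: "nat \<Rightarrow> nat \<Rightarrow> 'a"
  assumes P: "determined_by_past B P" and f: "unitriangular f"
    and row: "\<And>c'. c' \<in> {1..c} \<Longrightarrow> (r, c') \<in> B"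
    and y: "\<And>j. c < j \<Longrightarrow> y j = 0"
  shows "\<exists>D w. (\<forall>b. b \<notin> {r} \<times> {1..c} \<longrightarrow> D b = D0 b \<and> w b = w0 b) \<and>
    (\<forall>c'\<in>{1..c}. obeys P D w (r, c')) \<and> (\<forall>j\<ge>1. hor D w r f c j = y j)"
  using row y
proof (induction c arbitrary: D0 w0 y)
  case 0
  then show ?case by (intro exI[of _ D0] exI[of _ w0]) auto
next
  case (Suc c)
  define b where "b = (r, Suc c)"
  define x where "x = y (Suc c)"
  define t where "t = (if P D0 b then Black else if x = 0 then White else Plus)"
  \<comment> \<open>The residual target, obtained by solving the clause of \<open>hor\<close> for
    the rest of the row; for a \<open>+\<close> this divides by its nonzero weight.\<close>
  define y' where "y' = (\<lambda>j. case t of Plus \<Rightarrow> y j / x - f (Suc c) j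
    | Black \<Rightarrow> y j - x * f (Suc c) j | White \<Rightarrow> y j)"
  have f1: "f (Suc c) (Suc c) = 1" and f0: "\<And>j. Suc c < j \<Longrightarrow> f (Suc c) j = 0"
    using f by (auto simp: unitriangular_def)
  have x0: "t = Plus \<Longrightarrow> x \<noteq> 0" "t = White \<Longrightarrow> x = 0"
    and t_Black: "t = Black \<longleftrightarrow> P D0 b"
    by (auto simp: t_def split: if_splits)
  have row: "(r, c') \<in> B" if "c' \<in> {1..c}" for c'
    using Suc.prems(1)[of c'] that by simp
  \<comment> \<open>The choice of \<open>x\<close> cancels the coefficient at \<open>Suc c\<close>,
    as \<open>f (Suc c)\<close> has leading coefficient 1 there.\<close>
  have "y' j = 0" if "c < j" for j
  proof (cases "j = Suc c")
    case True
    then show ?thesis using f1 x0 by (auto simp: y'_def x_def split: filling.split)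
  next
    case False
    with that have "Suc c < j" by simp
    then show ?thesis using f0 Suc.prems(2) by (auto simp: y'_def split: filling.split)
  qed
  then obtain D w where
    off: "\<And>b'. b' \<notin> {r} \<times> {1..c} \<Longrightarrow> D b' = (D0(b \<mapsto> t)) b' \<and> w b' = (w0(b := x)) b'" and
    obeys: "\<And>c'. c' \<in> {1..c} \<Longrightarrow> obeys P D w (r, c')" and
    hor: "\<And>j. j \<ge> 1 \<Longrightarrow> hor D w r f c j = y' j"
    using Suc.IH[of y' "D0(b \<mapsto> t)" "w0(b := x)", OF row] by blast
  have Db: "D b = Some t" "w b = x"
    using off[of b] by (auto simp: b_def)
  \<comment> \<open>Filling the rest of the row touches only \<open>b\<close> and boxes read after
    it, so the decision made with \<open>D0\<close> stays valid.\<close>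
  have "P D b = P D0 b"
  proof (rule determined_by_pastD[OF P])
    show "b \<in> B" using Suc.prems(1)[of "Suc c"] by (simp add: b_def)
    show "D b' = D0 b'" if "precedes b' b" for b'
      using off[of b'] that by (cases b') (auto simp: precedes_def b_def)
  qed
  then have "obeys P D w b"
    using Db x0(1) t_Black by (simp add: obeys_def)
  with obeys have "obeys P D w (r, c')" if "c' \<in> {1..Suc c}" for c'
    using that by (cases "c' = Suc c") (auto simp: b_def)
  moreover have "hor D w r f (Suc c) j = y j" if "j \<ge> 1" for j
    using hor[OF that] Db x0 by (cases t) (auto simp: y'_def b_def)
  moreover have "D b' = D0 b' \<and> w b' = w0 b'" if "b' \<notin> {r} \<times> {1..Suc c}" for b'
    using off[of b'] that by (cases b') (auto simp: b_def)
  ultimately show ?case by blast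
qed

text \<open>At sink c+1 the rest of the row vanishes, leaving the weight of the box in column c+1,
  or 0 for a white stone. Since \<open>P\<close> decides blackness from the common past, this number
  fixes both content and weight. The hypothesis \<open>past\<close> speaks of boxes read before the
  whole row segment, so that the box just settled joins the past in the induction.\<close>

lemma row_unique:
  fixes f :: "nat \<Rightarrow> nat \<Rightarrow> 'a::field"
  assumes P: "determined_by_past B P" and f: "unitriangular f"
    and row: "\<And>c'. c' \<in> {1..c} \<Longrightarrow> (r, c') \<in> B"
    and past: "\<And>b. b \<in> B \<Longrightarrow> (\<And>c'. c' \<in> {1..c} \<Longrightarrow> precedes b (r, c')) \<Longrightarrow> D b = D' b"
    and ob: "\<And>c'. c' \<in> {1..c} \<Longrightarrow> obeys P D w (r, c')" "\<And>c'. c' \<in> {1..c} \<Longrightarrow> obeys P D' w' (r, c')"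
    and eq: "\<And>j. j \<in> {1..c} \<Longrightarrow> hor D w r f c j = hor D' w' r f c j"
    and "c' \<in> {1..c}"
  shows "D (r, c') = D' (r, c') \<and> (D (r, c') \<in> {Some Plus, Some Black} \<longrightarrow> w (r, c') = w' (r, c'))"
  using row past ob eq \<open>c' \<in> {1..c}\<close>
proof (induction c arbitrary: c')
  case (Suc c)
  let ?b = "(r, Suc c)"
  have f1: "f (Suc c) (Suc c) = 1"
    using f by (auto simp: unitriangular_def)
  have hor0: "hor D w r f c (Suc c) = 0" "hor D' w' r f c (Suc c) = 0"
    using hor_eq_0[OF f] by auto
  have "P D ?b = P D' ?b"
    using Suc.prems(2)
    by (rule_tac determined_by_pastD[OF P]) (use Suc.prems(1)[of "Suc c"] in \<open>auto simp: precedes_def\<close>)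
  moreover have "obeys P D w ?b" "obeys P D' w' ?b"
    using Suc.prems(3,4)[of "Suc c"] by auto
  moreover have "hor D w r f (Suc c) (Suc c) = hor D' w' r f (Suc c) (Suc c)"
    using Suc.prems(5) by simp
  ultimately have "D ?b = D' ?b \<and> (D ?b \<in> {Some Plus, Some Black} \<longrightarrow> w ?b = w' ?b) \<and>
      (D ?b = Some Plus \<longrightarrow> w ?b \<noteq> 0)"
    using f1 hor0 diagram_cases[of D ?b] diagram_cases[of D' ?b]
    unfolding obeys_def by (elim disjE) simp_all
  then have head: "D ?b = D' ?b" "D ?b \<in> {Some Plus, Some Black} \<Longrightarrow> w ?b = w' ?b"
    and nz: "D ?b = Some Plus \<Longrightarrow> w ?b \<noteq> 0"
    by blast+
  have tail: "D (r, c'') = D' (r, c'') \<and> (D (r, c'') \<in> {Some Plus, Some Black} \<longrightarrow> w (r, c'') = w' (r, c''))"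
    if c'': "c'' \<in> {1..c}" for c''
  proof (rule Suc.IH)
    show "D b = D' b" if "b \<in> B" and before: "\<And>c'. c' \<in> {1..c} \<Longrightarrow> precedes b (r, c')" for b
    proof (cases "b = ?b")
      case False
      moreover have "precedes b (r, c)"
        using before[of c] c'' by simp
      ultimately have "\<And>c'. c' \<in> {1..Suc c} \<Longrightarrow> precedes b (r, c')"
        by (cases b) (auto simp: precedes_def)
      then show ?thesis using Suc.prems(2) \<open>b \<in> B\<close> by blast
    qed (use head in simp)
    \<comment> \<open>The common box is cancelled from both sides; for a \<open>+\<close> this uses
      that its weight is nonzero.\<close>
    show "hor D w r f c j = hor D' w' r f c j" if "j \<in> {1..c}" for j
      using Suc.prems(5)[of j] that head nz by (auto split: if_splits)
    show "(r, c') \<in> B" "obeys P D w (r, c')" "obeys P D' w' (r, c')" if "c' \<in> {1..c}" for c'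
      using Suc.prems(1,3,4)[of c'] that by simp_all
  qed (rule c'')
  show ?case
  proof (cases "c' = Suc c")
    case True
    then show ?thesis using head by blast
  next
    case False
    then show ?thesis using tail[of c'] Suc.prems(6) by simp
  qed
qed simp

lemma obeys_cong:
  assumes P: "determined_by_past B P" and "b \<in> B"
    and "\<And>b'. b' = b \<or> precedes b' b \<Longrightarrow> D b' = D' b'" "w b = w' b"
  shows "obeys P D w b \<longleftrightarrow> obeys P D' w' b"
  using determined_by_pastD[OF P assms(2), of D D'] assms(3,4) by (simp add: obeys_def)

text \<open>Rows are filled from the bottom up. The vectors \<open>ver\<close> for a new row depend
  only on the finished rows, and the new row does not affect the entries of those below it.\<close>

lemma filling_exists:
  fixes m :: "nat \<Rightarrow> nat \<Rightarrow> 'a::field"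
  assumes P: "determined_by_past ({1..k} \<times> {1..l}) P"
    and m: "\<And>r j. l < j \<Longrightarrow> m r j = 0"
  shows "\<exists>D w. dom D = {1..k} \<times> {1..l} \<and> (\<forall>b\<in>{1..k} \<times> {1..l}. obeys P D w b) \<and>
    (\<forall>r\<in>{1..k}. \<forall>j\<ge>1. entry D w k l r j = m r j)"
proof -
  have "\<exists>D w. dom D \<subseteq> {k - q<..k} \<times> {1..l} \<and> (\<forall>b\<in>{k - q<..k} \<times> {1..l}. obeys P D w b) \<and>
      (\<forall>r\<in>{k - q<..k}. \<forall>j\<ge>1. entry D w k l r j = m r j)" if "q \<le> k" for q
    using that
  proof (induction q)
    case 0
    then show ?case by (intro exI[of _ Map.empty]) auto
  next
    case (Suc q)
    define r where "r = k - q"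
    have r: "r \<in> {1..k}" "{k - Suc q<..k} = insert r {r<..k}" "k - r = q"
      using Suc.prems by (auto simp: r_def)
    obtain D0 and w0 :: "nat \<times> nat \<Rightarrow> 'a" where dom0: "dom D0 \<subseteq> {r<..k} \<times> {1..l}"
      and obeys0: "\<And>b. b \<in> {r<..k} \<times> {1..l} \<Longrightarrow> obeys P D0 w0 b"
      and entry0: "\<And>r' j. r' \<in> {r<..k} \<Longrightarrow> j \<ge> 1 \<Longrightarrow> entry D0 w0 k l r' j = m r' j"
      using Suc.IH Suc.prems unfolding r_def by (meson Suc_leD)
    have row: "(r, c') \<in> {1..k} \<times> {1..l}" if "c' \<in> {1..l}" for c'
      using that r by auto
    obtain D w where off: "\<And>b. b \<notin> {r} \<times> {1..l} \<Longrightarrow> D b = D0 b \<and> w b = w0 b"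
      and obeys: "\<And>c'. c' \<in> {1..l} \<Longrightarrow> obeys P D w (r, c')"
      and hor: "\<And>j. j \<ge> 1 \<Longrightarrow> hor D w r (ver D0 w0 k q) l j = m r j"
    proof -
      have "\<exists>D w. (\<forall>b. b \<notin> {r} \<times> {1..l} \<longrightarrow> D b = D0 b \<and> w b = w0 b) \<and>
          (\<forall>c'\<in>{1..l}. obeys P D w (r, c')) \<and>
          (\<forall>j\<ge>1. hor D w r (ver D0 w0 k q) l j = m r j)"
        by (rule row_exists[OF P unitriangular_ver row m])
      then show thesis
        using that by blast
    qed
    have below: "D (r', c) = D0 (r', c)" "w (r', c) = w0 (r', c)" if "r < r'" for r' c
      using off[of "(r', c)"] that by auto
    have "dom D \<subseteq> {k - Suc q<..k} \<times> {1..l}"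
    proof
      fix b assume "b \<in> dom D"
      then have "b \<in> {r} \<times> {1..l} \<or> b \<in> dom D0"
        using off[of b] by (cases "b \<in> {r} \<times> {1..l}") (simp_all add: domIff)
      then show "b \<in> {k - Suc q<..k} \<times> {1..l}"
        unfolding r(2) using dom0 by auto
    qed
    moreover have "obeys P D w b" if b: "b \<in> {k - Suc q<..k} \<times> {1..l}" for b
    proof (cases "fst b = r")
      case True
      then show ?thesis using obeys[of "snd b"] b by auto
    next
      case False
      then have below_b: "b \<in> {r<..k} \<times> {1..l}"
        using b unfolding r(2) by auto
      have "obeys P D w b \<longleftrightarrow> obeys P D0 w0 b"
      proof (rule obeys_cong[OF P])
        show "b \<in> {1..k} \<times> {1..l}" using below_b by auto
        show "D b' = D0 b'" if "b' = b \<or> precedes b' b" for b'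
          using that below_b below(1)[of "fst b'" "snd b'"] by (auto simp: precedes_def)
        show "w b = w0 b"
          using below_b below(2)[of "fst b" "snd b"] by auto
      qed
      then show ?thesis using obeys0[OF below_b] by simp
    qed
    moreover have "entry D w k l r' j = m r' j" if "r' \<in> {k - Suc q<..k}" "j \<ge> 1" for r' j
    proof (cases "r' = r")
      case True
      have "hor D w r (ver D w k q) l j = hor D w r (ver D0 w0 k q) l j"
      proof (rule hor_cong)
        fix c assume c: "c \<in> {1..l}"
        show "ver D w k q c j = ver D0 w0 k q c j"
        proof (rule ver_cong)
          show "D b = D0 b" "w b = w0 b" if "b \<in> {k - q<..k} \<times> {1..l}" for b
            using that below[of "fst b" "snd b"] unfolding r_def by auto
        qed (use c Suc.prems in auto)
      qed simp_all
      then show ?thesis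
        using hor[OF that(2)] True r(3) by (simp add: entry_def)
    next
      case False
      then have r': "r' \<in> {r<..k}" using that(1) unfolding r(2) by simp
      have "entry D w k l r' j = entry D0 w0 k l r' j"
      proof (rule entry_cong)
        show "r' \<in> {1..k}" using r' by auto
        show "D b = D0 b" "w b = w0 b" if "b \<in> {r'..k} \<times> {1..l}" for b
          using that r' below[of "fst b" "snd b"] by auto
      qed
      then show ?thesis using entry0[OF r' that(2)] by simp
    qed
    ultimately show ?case by blast
  qed
  note filled = this[of k, OF order_refl]
  have "{k - k<..k} = {1..k}" by auto
  with filled obtain D w where D: "dom D \<subseteq> {1..k} \<times> {1..l}"
    and obeys: "\<And>b. b \<in> {1..k} \<times> {1..l} \<Longrightarrow> obeys P D w b"
    and entry: "\<And>r j. r \<in> {1..k} \<Longrightarrow> j \<ge> 1 \<Longrightarrow> entry D w k l r j = m r j"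
    by (simp only:) blast
  \<comment> \<open>\<open>obeys\<close> rules out \<open>None\<close>, so the inclusion of domains
    carried through the induction becomes an equality.\<close>
  moreover have "{1..k} \<times> {1..l} \<subseteq> dom D"
    using obeys by (auto simp: obeys_def domIff)
  ultimately show ?thesis by blast
qed

text \<open>Once the lower rows agree, both fillings give the next row the same vectors
  \<open>ver\<close>, and \<open>row_unique\<close> applies to it.\<close>

lemma filling_unique:
  fixes w w' :: "nat \<times> nat \<Rightarrow> 'a::field"
  assumes P: "determined_by_past ({1..k} \<times> {1..l}) P"
    and ob: "\<And>b. b \<in> {1..k} \<times> {1..l} \<Longrightarrow> obeys P D w b"
      "\<And>b. b \<in> {1..k} \<times> {1..l} \<Longrightarrow> obeys P D' w' b"
    and entry: "\<And>r j. r \<in> {1..k} \<Longrightarrow> j \<in> {1..l} \<Longrightarrow> entry D w k l r j = entry D' w' k l r j"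
    and b: "b \<in> {1..k} \<times> {1..l}"
  shows "D b = D' b \<and> (D b \<in> {Some Plus, Some Black} \<longrightarrow> w b = w' b)"
proof -
  have "\<forall>b\<in>{k - q<..k} \<times> {1..l}. D b = D' b \<and> (D b \<in> {Some Plus, Some Black} \<longrightarrow> w b = w' b)"
    if "q \<le> k" for q
    using that
  proof (induction q)
    case (Suc q)
    define r where "r = k - q"
    have r: "r \<in> {1..k}" "{k - Suc q<..k} = insert r {r<..k}" "k - r = q"
      using Suc.prems by (auto simp: r_def)
    have IH: "D b = D' b" "D b \<in> {Some Plus, Some Black} \<Longrightarrow> w b = w' b"
      if "b \<in> {r<..k} \<times> {1..l}" for b
      using Suc.IH Suc.prems that unfolding r_def by auto
    have "D (r, c) = D' (r, c) \<and> (D (r, c) \<in> {Some Plus, Some Black} \<longrightarrow> w (r, c) = w' (r, c))"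
      if "c \<in> {1..l}" for c
    proof (rule row_unique[OF P unitriangular_ver[of D w k q] _ _ _ _ _ that])
      show "(r, c') \<in> {1..k} \<times> {1..l}" "obeys P D w (r, c')" "obeys P D' w' (r, c')"
        if "c' \<in> {1..l}" for c'
        using that r(1) ob by auto
      show "D b = D' b"
        if "b \<in> {1..k} \<times> {1..l}" "\<And>c'. c' \<in> {1..l} \<Longrightarrow> precedes b (r, c')" for b
      proof (rule IH(1))
        \<comment> \<open>Being read before the rightmost box of row \<open>r\<close> forces a box
          of the rectangle into a lower row.\<close>
        have "precedes b (r, l)" using that(2)[of l] that(1) by auto
        then show "b \<in> {r<..k} \<times> {1..l}"
          using that(1) by (auto simp: precedes_def)
      qed
      show "hor D w r (ver D w k q) l j = hor D' w' r (ver D w k q) l j" if "j \<in> {1..l}" for j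
      proof -
        have "hor D' w' r (ver D w k q) l j = hor D' w' r (ver D' w' k q) l j"
        proof (rule hor_cong)
          fix c assume c: "c \<in> {1..l}"
          show "ver D w k q c j = ver D' w' k q c j"
          proof (rule ver_cong)
            show "D b = D' b" "D b \<in> {Some Plus, Some Black} \<Longrightarrow> w b = w' b"
              if "b \<in> {k - q<..k} \<times> {1..l}" for b
              using IH that unfolding r_def by auto
          qed (use c Suc.prems in auto)
        qed simp_all
        then show ?thesis
          using entry[OF r(1) that] r(3) by (simp add: entry_def)
      qed
    qed
    then show ?case
      unfolding r(2) using IH by blast
  qed simp
  moreover have "{k - k<..k} = {1..k}" by auto
  ultimately show ?thesis
    using b by (metis order_refl)
qed


section \<open>Translation of the theorem into fillings of the rectangle\<close>

lemma go_network_iff: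
  fixes M :: "'a::field mat" and a c :: "nat \<times> nat \<Rightarrow> 'a"
  shows "partition_in_rect k l lam \<and> go_diagram k l lam D \<and> weight_choice D a c \<and>
    source_labels k l lam = {1..k} \<and>
    (\<forall>i\<in>{1..k}. \<forall>j\<in>{1..l}.
       M $$ (i - 1, j - 1) = (\<Sum>P\<in>network_paths k l lam D i (k + j). path_weight D a c P)) \<longleftrightarrow>
    lam = full_rect k l \<and> dom D = {1..k} \<times> {1..l} \<and>
    (\<forall>b\<in>{1..k} \<times> {1..l}. obeys (descent_at k l) D (box_weight D a c) b) \<and>
    a \<in> extensional (plus_boxes D) \<and> c \<in> extensional (black_boxes D) \<and>
    (\<forall>r\<in>{1..k}. \<forall>j\<in>{1..l}. entry D (box_weight D a c) k l r j = M $$ (r - 1, l - j))"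
    (is "?L \<longleftrightarrow> ?R")
proof -
  let ?B = "{1..k} \<times> {1..l}"
  have weights: "go_diagram k l (full_rect k l) D \<and> weight_choice D a c \<longleftrightarrow>
      dom D = ?B \<and> (\<forall>b\<in>?B. obeys (descent_at k l) D (box_weight D a c) b) \<and>
      a \<in> extensional (plus_boxes D) \<and> c \<in> extensional (black_boxes D)"
  proof (cases "dom D = ?B")
    case True
    then have "D b \<noteq> None \<longleftrightarrow> b \<in> ?B" for b
      by (metis domIff)
    moreover from this have "plus_boxes D \<subseteq> ?B"
      by (auto simp: plus_boxes_def)
    ultimately have "(\<forall>b\<in>?B. obeys (descent_at k l) D (box_weight D a c) b) \<longleftrightarrow>
        (\<forall>b\<in>?B. D b = Some Black \<longleftrightarrow> descent_at k l D b) \<and> (\<forall>b\<in>plus_boxes D. a b \<noteq> 0)"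
      by (auto simp: obeys_def box_weight_def plus_boxes_def)
    then show ?thesis
      using True by (auto simp: go_diagram_full_rect_iff weight_choice_def PiE_def Pi_def)
  qed (simp add: go_diagram_full_rect_iff)
  have entries: "(\<forall>i\<in>{1..k}. \<forall>j\<in>{1..l}. M $$ (i - 1, j - 1) =
        (\<Sum>P\<in>network_paths k l (full_rect k l) D i (k + j). path_weight D a c P)) \<longleftrightarrow>
      (\<forall>r\<in>{1..k}. \<forall>j\<in>{1..l}. entry D (box_weight D a c) k l r j = M $$ (r - 1, l - j))"
    if dom: "dom D = ?B"
  proof -
    have "(\<Sum>P\<in>network_paths k l (full_rect k l) D i (k + j). path_weight D a c P) =
        entry D (box_weight D a c) k l i (Suc l - j)" if "i \<in> {1..k}" "j \<in> {1..l}" for i j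
      using path_sum_eq_entry[OF dom _ _ that(1), of "k + j" a c] that(2) by simp
    then have "(\<forall>i\<in>{1..k}. \<forall>j\<in>{1..l}. M $$ (i - 1, j - 1) =
          (\<Sum>P\<in>network_paths k l (full_rect k l) D i (k + j). path_weight D a c P)) \<longleftrightarrow>
        (\<forall>i\<in>{1..k}. \<forall>j\<in>{1..l}. entry D (box_weight D a c) k l i (Suc l - j) = M $$ (i - 1, j - 1))"
      by (intro ball_cong[OF refl]) auto
    also have "\<dots> \<longleftrightarrow>
        (\<forall>r\<in>{1..k}. \<forall>j\<in>{1..l}. entry D (box_weight D a c) k l r j = M $$ (r - 1, l - j))"
    proof (rule ball_cong[OF refl])
      \<comment> \<open>The reflection j to l + 1 - j exchanges sink numbers with columns of the
        rectangle; on the matrix, whose indices start at 0, it turns j - 1 into l - j.\<close>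
      fix r
      have rev: "Suc l - j \<in> {1..l}" "Suc l - (Suc l - j) = j" "Suc l - j - 1 = l - j"
        if "j \<in> {1..l}" for j
        using that by auto
      show "(\<forall>j\<in>{1..l}. entry D (box_weight D a c) k l r (Suc l - j) = M $$ (r - 1, j - 1)) \<longleftrightarrow>
          (\<forall>j\<in>{1..l}. entry D (box_weight D a c) k l r j = M $$ (r - 1, l - j))"
      proof (intro iffI ballI)
        fix j assume "\<forall>j\<in>{1..l}. entry D (box_weight D a c) k l r (Suc l - j) = M $$ (r - 1, j - 1)"
          and j: "j \<in> {1..l}"
        from bspec[OF this(1) rev(1)[OF j]]
        show "entry D (box_weight D a c) k l r j = M $$ (r - 1, l - j)"
          unfolding rev(2,3)[OF j] .
      next
        fix j assume "\<forall>j\<in>{1..l}. entry D (box_weight D a c) k l r j = M $$ (r - 1, l - j)"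
          and j: "j \<in> {1..l}"
        from bspec[OF this(1) rev(1)[OF j]]
        show "entry D (box_weight D a c) k l r (Suc l - j) = M $$ (r - 1, j - 1)"
          using j by simp
      qed
    qed
    finally show ?thesis .
  qed
  have go_dom: "dom D = ?B" if "go_diagram k l (full_rect k l) D"
    using that by (simp add: go_diagram_full_rect_iff)
  show ?thesis
  proof (cases "lam = full_rect k l")
    case True
    have initial: "partition_in_rect k l (full_rect k l)" "source_labels k l (full_rect k l) = {1..k}"
      using partition_full_rect source_labels_initial_iff by auto
    show ?thesis
    proof (cases "dom D = ?B")
      case dom: True
      show ?thesis
        unfolding True using initial weights entries[OF dom] by argo
    next
      case False
      then show ?thesis
        unfolding True using go_dom by argo
    qed
  next
    case False
    then show ?thesis
      using source_labels_initial_iff by blast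
  qed
qed

theorem corollary3p17:
  fixes k l :: nat and M :: "'a::field mat"
  assumes "M \<in> carrier_mat k l"
  shows "\<exists>!(lam, D, a, c).
    partition_in_rect k l lam \<and> go_diagram k l lam D \<and> weight_choice D a c \<and>
    source_labels k l lam = {1..k} \<and>
    (\<forall>i\<in>{1..k}. \<forall>j\<in>{1..l}.
       M $$ (i - 1, j - 1) = (\<Sum>P\<in>network_paths k l lam D i (k + j). path_weight D a c P))"
  unfolding go_network_iff
proof -
  let ?B = "{1..k} \<times> {1..l}"
  let ?P = "\<lambda>lam D (a :: nat \<times> nat \<Rightarrow> 'a) c. lam = full_rect k l \<and> dom D = ?B \<and>
    (\<forall>b\<in>?B. obeys (descent_at k l) D (box_weight D a c) b) \<and>
    a \<in> extensional (plus_boxes D) \<and> c \<in> extensional (black_boxes D) \<and>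
    (\<forall>r\<in>{1..k}. \<forall>j\<in>{1..l}. entry D (box_weight D a c) k l r j = M $$ (r - 1, l - j))"
  have past: "determined_by_past ?B (descent_at k l)"
    unfolding determined_by_past_def
  proof (intro ballI allI impI)
    fix b and D D' :: diagram assume b: "b \<in> ?B" and "\<forall>b'\<in>?B. precedes b' b \<longrightarrow> D b' = D' b'"
    then show "descent_at k l D b = descent_at k l D' b"
      by (intro descent_at_cong) auto
  qed
  \<comment> \<open>The row is continued by 0 beyond column l, as \<open>filling_exists\<close>
    requires; the expression \<open>l - j\<close> would truncate there.\<close>
  define m where "m = (\<lambda>r j. if j \<le> l then M $$ (r - 1, l - j) else 0)"
  have m0: "m r j = 0" if "l < j" for r j
    using that by (simp add: m_def)
  obtain D w where dom: "dom D = ?B" and obeys: "\<And>b. b \<in> ?B \<Longrightarrow> obeys (descent_at k l) D w b"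
    and entry: "\<And>r j. r \<in> {1..k} \<Longrightarrow> j \<ge> 1 \<Longrightarrow> entry D w k l r j = m r j"
    using filling_exists[OF past, of m, OF m0] by blast
  \<comment> \<open>The single weight function is split into the two families, made extensional as
    \<open>weight_choice\<close> demands.\<close>
  define a where "a = restrict w (plus_boxes D)"
  define c where "c = restrict w (black_boxes D)"
  have weight: "box_weight D a c b = w b" if "D b \<in> {Some Plus, Some Black}" for b
    using that by (auto simp: box_weight_def a_def c_def plus_boxes_def black_boxes_def)
  have "entry D (box_weight D a c) k l r j = M $$ (r - 1, l - j)" if "r \<in> {1..k}" "j \<in> {1..l}" for r j
  proof -
    \<comment> \<open>Inside the rectangle the two weight functions can differ only at white stones,
      whereas \<open>entry_cong\<close> compares them at \<open>+\<close> and black boxes.\<close>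
    have "entry D (box_weight D a c) k l r j = entry D w k l r j"
      by (rule entry_cong) (use weight that in auto)
    then show ?thesis
      using entry[OF that(1), of j] that(2) by (simp add: m_def)
  qed
  moreover have "obeys (descent_at k l) D (box_weight D a c) b" if "b \<in> ?B" for b
    using obeys[OF that] weight[of b] by (auto simp: obeys_def)
  ultimately have ex: "?P (full_rect k l) D a c"
    using dom by (simp add: a_def c_def)
  have unique: "D' = D \<and> a' = a \<and> c' = c" if "?P lam D' a' c'" for lam D' a' c'
  proof -
    have agree: "D' b = D b \<and>
        (D' b \<in> {Some Plus, Some Black} \<longrightarrow> box_weight D' a' c' b = box_weight D a c b)" if "b \<in> ?B" for b
      by (rule filling_unique[OF past _ _ _ that]) (use \<open>?P lam D' a' c'\<close> ex in auto)
    have D: "D' = D"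
    proof
      fix b show "D' b = D b"
      proof (cases "b \<in> ?B")
        case False
        then show ?thesis using ex that by (metis domIff)
      qed (use agree in blast)
    qed
    have in_rect: "b \<in> ?B" if "D b \<noteq> None" for b
      using ex that by blast
    have "a' = a"
    proof (rule extensionalityI)
      show "a' b = a b" if "b \<in> plus_boxes D" for b
        using agree[OF in_rect[of b]] that D by (simp add: plus_boxes_def box_weight_def)
    qed (use that ex D in blast)+
    moreover have "c' = c"
    proof (rule extensionalityI)
      show "c' b = c b" if "b \<in> black_boxes D" for b
        using agree[OF in_rect[of b]] that D by (simp add: black_boxes_def box_weight_def)
    qed (use that ex D in blast)+
    ultimately show ?thesis using D by blast
  qed
  show "\<exists>!(lam, D, a, c). ?P lam D a c"
  proof (rule ex1I[of _ "(full_rect k l, D, a, c)"])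
    show "case (full_rect k l, D, a, c) of (lam, D, a, c) \<Rightarrow> ?P lam D a c"
      using ex by simp
    fix x assume "case x of (lam, D, a, c) \<Rightarrow> ?P lam D a c"
    then show "x = (full_rect k l, D, a, c)"
      using unique by (cases x) auto
  qed
qed

end
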